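(* Let $T$ be an operator acting on measurable functions on $\mathbb{R}^n$, and suppose that for some $1<p_0<\infty$, some constant $c>0$ and some $\beta>0$, \[ \|T\|_{L^{p_0}(w)\to L^{p_0,\infty}(w)}\le c\,[w]_{A_{p_0}}^{\beta}\qquad\text{for every } w\in A_{p_0}. \] Then \[ \beta\ \ge\ \max\Big\{\gamma_T,\ \frac{\alpha_T}{p_0-1}\Big\}, \] where \[ \alpha_T=\sup\Big\{\alpha\ge 0:\ \forall\varepsilon>0,\ \limsup_{p\to1^+}(p-1)^{\alpha-\varepsilon}\|T\|_{L^p\to L^{p,\infty}}=\infty\Big\}, \qquad \gamma_T=\sup\Big\{\gamma\ge 0:\ \forall\varepsilon>0,\ \limsup_{p\to\infty}\frac{\|T\|_{L^p\to L^{p,\infty}}}{p^{\gamma-\varepsilon}}=\infty\Big\}, \] with the convention $\sup\emptyset=0$, and $\|T\|_{L^p\to L^{p,\infty}}$ denotes the (possibly infinite) operator norm from unweighted $L^p(\mathbb{R}^n)$ to unweighted $L^{p,\infty}(\mathbb{R}^n)$.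
   Context: A weight is a non-negative locally integrable function on $\mathbb{R}^n$. For $1<p<\infty$, $w\in A_p$ means $[w]_{A_p}=\sup_Q\big(\frac{1}{|Q|}\int_Q w\big)\big(\frac{1}{|Q|}\int_Q w^{-\frac{1}{p-1}}\big)^{p-1}<\infty$, the supremum over all cubes $Q$ with sides parallel to the axes. $L^{p,\infty}(w)$ is the weak Lebesgue space with quasi-norm $\|g\|_{L^{p,\infty}(w)}=\sup_{\lambda>0}\lambda\, w(\{x:|g(x)|>\lambda\})^{1/p}$, and $\|T\|_{L^{p}(w)\to L^{p,\infty}(w)}=\sup\{\|Tf\|_{L^{p,\infty}(w)}:\|f\|_{L^p(w)}\le1\}$. *)

theory Defs
  imports "HOL-Analysis.Analysis"
begin

text \<open>Real power of an extended non-negative real, for a positive exponent r: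
  infinity stays infinity.\<close>
definition enn_powr :: "ennreal \<Rightarrow> real \<Rightarrow> ennreal" where
  "enn_powr x r = (if x = top then top else ennreal (enn2real x powr r))"

definition is_cube :: "'a::euclidean_space set \<Rightarrow> bool" where
  "is_cube Q \<longleftrightarrow> (\<exists>a r. r > 0 \<and> Q = cbox a (a + r *\<^sub>R One))"

definition is_weight :: "('a::euclidean_space \<Rightarrow> real) \<Rightarrow> bool" where
  "is_weight w \<longleftrightarrow> w \<in> borel_measurable lborel \<and> (\<forall>x. 0 \<le> w x) \<and>
     (\<forall>K. compact K \<longrightarrow> set_integrable lborel K w)"

definition cube_avg :: "('a::euclidean_space \<Rightarrow> ennreal) \<Rightarrow> 'a set \<Rightarrow> ennreal" where
  "cube_avg g Q = (\<integral>\<^sup>+ x\<in>Q. g x \<partial>lborel) / emeasure lborel Q"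

text \<open>The A_p characteristic [w]_{A_p} (possibly infinite).  The dual weight
  w^{-1/(p-1)} is taken with value \<infinity> where w = 0; if its average over a cube is
  infinite the corresponding term is \<infinity>.\<close>
definition Ap_const :: "real \<Rightarrow> ('a::euclidean_space \<Rightarrow> real) \<Rightarrow> ennreal" where
  "Ap_const p w = (SUP Q \<in> Collect is_cube.
     (let a1 = cube_avg (\<lambda>x. ennreal (w x)) Q;
          a2 = cube_avg (\<lambda>x. inverse (ennreal (w x powr (1 / (p - 1))))) Q
      in if a2 = top then top else a1 * enn_powr a2 (p - 1)))"

definition in_Ap :: "real \<Rightarrow> ('a::euclidean_space \<Rightarrow> real) \<Rightarrow> bool" where
  "in_Ap p w \<longleftrightarrow> is_weight w \<and> Ap_const p w < top"

definition Lp_norm :: "real \<Rightarrow> ('a::euclidean_space \<Rightarrow> real) \<Rightarrow> ('a \<Rightarrow> real) \<Rightarrow> ennreal" where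
  "Lp_norm p w f = enn_powr (\<integral>\<^sup>+ x. ennreal (\<bar>f x\<bar> powr p * w x) \<partial>lborel) (1 / p)"

definition wmeasure :: "('a::euclidean_space \<Rightarrow> real) \<Rightarrow> 'a set \<Rightarrow> ennreal" where
  "wmeasure w E = (\<integral>\<^sup>+ x\<in>E. ennreal (w x) \<partial>lborel)"

definition weak_Lp_norm :: "real \<Rightarrow> ('a::euclidean_space \<Rightarrow> real) \<Rightarrow> ('a \<Rightarrow> real) \<Rightarrow> ennreal" where
  "weak_Lp_norm p w g = (SUP t \<in> {0<..}. ennreal t * enn_powr (wmeasure w {x. \<bar>g x\<bar> > t}) (1 / p))"

definition weak_op_norm ::
  "(('a::euclidean_space \<Rightarrow> real) \<Rightarrow> ('a \<Rightarrow> real)) \<Rightarrow> real \<Rightarrow> ('a \<Rightarrow> real) \<Rightarrow> ennreal" where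
  "weak_op_norm T p w = (SUP f \<in> {f. f \<in> borel_measurable lborel \<and> Lp_norm p w f \<le> 1}.
      weak_Lp_norm p w (T f))"

definition unw_op_norm :: "(('a::euclidean_space \<Rightarrow> real) \<Rightarrow> ('a \<Rightarrow> real)) \<Rightarrow> real \<Rightarrow> ennreal" where
  "unw_op_norm T p = weak_op_norm T p (\<lambda>_. 1)"

text \<open>The exponents alpha_T and gamma_T (sup of the empty set is 0; values may be \<infinity>).\<close>
definition alpha_T :: "(('a::euclidean_space \<Rightarrow> real) \<Rightarrow> ('a \<Rightarrow> real)) \<Rightarrow> ereal" where
  "alpha_T T = Sup (insert 0 (ereal ` {\<alpha>. \<alpha> \<ge> 0 \<and> (\<forall>\<epsilon>>0.
      Limsup (at_right 1) (\<lambda>p. ennreal ((p - 1) powr (\<alpha> - \<epsilon>)) * unw_op_norm T p) = top)}))"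

definition gamma_T :: "(('a::euclidean_space \<Rightarrow> real) \<Rightarrow> ('a \<Rightarrow> real)) \<Rightarrow> ereal" where
  "gamma_T T = Sup (insert 0 (ereal ` {\<gamma>. \<gamma> \<ge> 0 \<and> (\<forall>\<epsilon>>0.
      Limsup at_top (\<lambda>p. unw_op_norm T p / ennreal (p powr (\<gamma> - \<epsilon>))) = top)}))"

end

theory Submission
  imports Defs
begin

text \<open>
  Quantitative Rubio de Francia extrapolation. On \<open>L\<^sup>q\<close> with \<open>1 < q \<le> 2\<close> the maximal operator is
  bounded by \<open>C / (q - 1)\<close>, so every \<open>h\<close> in the unit ball of \<open>L\<^sup>q\<close> has, up to a factor \<open>4\<close>, a
  majorant \<open>g\<close> in that ball whose \<open>A\<^sub>1\<close> constant is at most \<open>K = C / (q - 1)\<close>.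

  For \<open>p\<close> close to \<open>1\<close>, take \<open>h = f\<close>, \<open>q = p\<close> and the weight \<open>(4 g)\<^bsup>-(p0 - p)\<^esup>\<close>, whose \<open>A\<^bsub>p0\<^esub>\<close>
  constant is at most a multiple of \<open>K\<^bsup>p0 - p\<^esup>\<close>: the hypothesis gives the unweighted bound
  \<open>O((p - 1)\<^bsup>-\<beta> (p0 - 1)\<^esup>)\<close>. For large \<open>p\<close>, take for \<open>h\<close> the normalised indicator of a level
  set, \<open>q = (p / p0)'\<close> and the weight \<open>g\<close>, whose \<open>A\<^bsub>p0\<^esub>\<close> constant is at most \<open>K = O(p)\<close>: this gives
  \<open>O(p\<^sup>\<beta>)\<close>. In both cases \<open>f\<close> stays in the unit ball of the weighted space, so no
  homogeneity of \<open>T\<close> is involved.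
\<close>

section \<open>Powers of extended non-negative reals\<close>

lemma enn_powr_ennreal: "0 \<le> x \<Longrightarrow> enn_powr (ennreal x) r = ennreal (x powr r)"
  by (simp add: enn_powr_def)

lemma enn_powr_top: "enn_powr top r = top"
  by (simp add: enn_powr_def)

lemma enn_powr_mono:
  assumes "0 < r" "x \<le> y"
  shows "enn_powr x r \<le> enn_powr y r"
proof (cases "y = top")
  case False
  with assms have "x \<noteq> top" using top.extremum_unique by auto
  with False assms show ?thesis
    by (auto simp: enn_powr_def enn2real_mono top.not_eq_extremum intro!: ennreal_leI powr_mono2)
qed (simp add: enn_powr_top)

lemma enn_powr_powr: "enn_powr (enn_powr x r) s = enn_powr x (r * s)"
  by (cases x) (auto simp: enn_powr_def powr_powr)

lemma enn_powr_one: "enn_powr x 1 = x"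
  by (cases x) (auto simp: enn_powr_def)

lemma enn_powr_inverse_inverse:
  "0 < r \<Longrightarrow> enn_powr (enn_powr x (1 / r)) r = x"
  "0 < r \<Longrightarrow> enn_powr (enn_powr x r) (1 / r) = x"
  by (simp_all add: enn_powr_powr enn_powr_one)

lemma enn_powr_le_iff:
  assumes "0 < r"
  shows "enn_powr x r \<le> enn_powr y r \<longleftrightarrow> x \<le> y"
proof
  assume "enn_powr x r \<le> enn_powr y r"
  then have "enn_powr (enn_powr x r) (1 / r) \<le> enn_powr (enn_powr y r) (1 / r)"
    using assms by (subst enn_powr_mono) auto
  then show "x \<le> y" using assms by (simp add: enn_powr_inverse_inverse)
qed (use assms enn_powr_mono in auto)

lemma enn_powr_root_le_iff:
  assumes "0 < r"
  shows "enn_powr x (1 / r) \<le> y \<longleftrightarrow> x \<le> enn_powr y r"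
  using enn_powr_le_iff[OF assms, of "enn_powr x (1 / r)" y] assms
  by (simp add: enn_powr_inverse_inverse)

text \<open>The delicate case is zero times infinity: both sides are then 0, since
  \<open>0 powr r = 0\<close>.\<close>

lemma enn_powr_mult:
  assumes "0 < r"
  shows "enn_powr (x * y) r = enn_powr x r * enn_powr y r"
proof (cases "x = top \<or> y = top")
  case True
  then show ?thesis
    using assms by (auto simp: enn_powr_def ennreal_mult_eq_top_iff ennreal_mult_top ennreal_top_mult
        ennreal_eq_0_iff enn2real_eq_0_iff)
next
  case False
  then obtain a b where "x = ennreal a" "y = ennreal b" "0 \<le> a" "0 \<le> b"
    by (cases x; cases y) auto
  then show ?thesis
    by (simp add: enn_powr_ennreal powr_mult flip: ennreal_mult)
qed

text \<open>The power is an increasing bijection with inverse the power \<open>1 / r\<close>. Moving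
  it to the other side reduces the claim to the defining property of the supremum, with no
  continuity argument.\<close>

lemma enn_powr_SUP_le:
  assumes "0 < r"
  shows "enn_powr (SUP i\<in>I. f i) r \<le> (SUP i\<in>I. enn_powr (f i) r)"
proof -
  let ?S = "SUP i\<in>I. enn_powr (f i) r"
  have "f i \<le> enn_powr ?S (1 / r)" if "i \<in> I" for i
  proof -
    have "enn_powr (f i) r \<le> ?S" using that by (rule SUP_upper)
    then have "enn_powr (enn_powr (f i) r) (1 / r) \<le> enn_powr ?S (1 / r)"
      using assms by (intro enn_powr_mono) auto
    then show ?thesis using assms by (simp add: enn_powr_inverse_inverse)
  qed
  then have "(SUP i\<in>I. f i) \<le> enn_powr ?S (1 / r)" by (rule SUP_least)
  then have "enn_powr (SUP i\<in>I. f i) r \<le> enn_powr (enn_powr ?S (1 / r)) r"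
    using assms by (intro enn_powr_mono)
  then show ?thesis using assms by (simp add: enn_powr_inverse_inverse)
qed

lemma borel_measurable_enn_powr [measurable]:
  assumes [measurable]: "f \<in> borel_measurable M"
  shows "(\<lambda>x. enn_powr (f x) r) \<in> borel_measurable M"
  unfolding enn_powr_def by measurable

section \<open>Convexity of powers and the layer-cake formula\<close>

lemma powr_mean_le:
  fixes a b p :: real
  assumes "1 \<le> p" "0 \<le> a" "0 \<le> b"
  shows "((a + b) / 2) powr p \<le> (a powr p + b powr p) / 2"
\<comment> \<open>\<open>powr_convex\<close> gives convexity on the open half-line; a zero argument
  is covered by \<open>(1 / 2) powr p <= 1 / 2\<close>.\<close>
proof (cases "a = 0 \<or> b = 0")
  case True
  have "(c / 2) powr p \<le> c powr p / 2" if "0 \<le> c" for c :: real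
  proof -
    have "(1 / 2) powr p \<le> (1 / 2 :: real) powr 1"
      using assms by (intro powr_mono') auto
    then have "c powr p * (1 / 2) powr p \<le> c powr p * (1 / 2)"
      by (intro mult_left_mono) auto
    then show ?thesis using that by (simp add: powr_divide)
  qed
  with True assms show ?thesis by auto
next
  case False
  with assms have "a \<in> {0<..}" "b \<in> {0<..}" by auto
  then show ?thesis
    using convex_onD[OF powr_convex[OF assms(1)], of "1/2" a b]
    by (simp add: field_simps)
qed

lemma enn_powr_mean_le:
  assumes "1 \<le> p"
  shows "enn_powr ((x + y) / 2) p \<le> (enn_powr x p + enn_powr y p) / 2"
proof (cases "x = top \<or> y = top")
  case True
  then have "(enn_powr x p + enn_powr y p) / 2 = top"
    by (auto simp: enn_powr_top ennreal_top_divide)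
  then show ?thesis by simp
next
  case False
  then obtain a b where "x = ennreal a" "y = ennreal b" "0 \<le> a" "0 \<le> b"
    by (cases x; cases y) auto
  moreover have "ennreal u / 2 = ennreal (u / 2)" if "0 \<le> u" for u
    using that divide_ennreal[of u 2] by simp
  ultimately show ?thesis
    using powr_mean_le[OF assms, of a b]
    by (simp add: enn_powr_ennreal ennreal_leI flip: ennreal_plus)
qed

lemma enn_powr_eq_nn_integral:
  assumes "0 < a"
  shows "enn_powr u a =
    (\<integral>\<^sup>+t. ennreal (a * t powr (a - 1)) * indicator {t. 0 < t \<and> ennreal t < u} t \<partial>lborel)" (is "_ = ?I u")
proof -
  have fin: "?I (ennreal c) = ennreal (c powr a)" if "0 \<le> c" for c
  proof -
    have "((\<lambda>t. t powr (a - 1)) has_integral (c powr a / a)) {0..c}"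
      using has_integral_powr_from_0[of "a - 1" c] assms that by simp
    then have "((\<lambda>t. a * t powr (a - 1)) has_integral (c powr a)) {0..c}"
      using has_integral_mult_right[of "\<lambda>t. t powr (a - 1)" "c powr a / a" "{0..c}" a] assms by simp
    then have "(\<integral>\<^sup>+t. indicator {0..c} t * ennreal (a * t powr (a - 1)) \<partial>lborel) = ennreal (c powr a)"
      using nn_integral_has_integral_lebesgue[of "{0..c}" "\<lambda>t. a * t powr (a - 1)" "c powr a"] assms
      by (simp add: ennreal_mult' ennreal_indicator)
    also have "(\<integral>\<^sup>+t. indicator {0..c} t * ennreal (a * t powr (a - 1)) \<partial>lborel) = ?I (ennreal c)"
    proof (rule nn_integral_cong_AE)
      \<comment> \<open>The closed interval \<open>{0..c}\<close> and the open condition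
        \<open>0 < t < c\<close> differ only at the two endpoints, a null set.\<close>
      have "AE t in lborel. t \<noteq> 0 \<and> t \<noteq> c"
        by (intro AE_conjI AE_lborel_singleton)
      then show "AE t in lborel. indicator {0..c} t * ennreal (a * t powr (a - 1)) =
          ennreal (a * t powr (a - 1)) * indicator {t. 0 < t \<and> ennreal t < ennreal c} t"
        by eventually_elim (auto simp: indicator_def ennreal_less_iff)
    qed
    finally show ?thesis .
  qed
  show ?thesis
  proof (cases u)
    case (real c)
    then show ?thesis using fin by (simp add: enn_powr_ennreal)
  next
    case top
    have le: "ennreal (c powr a) \<le> ?I top" if "0 \<le> c" for c
      unfolding fin[OF that, symmetric]
      by (intro nn_integral_mono mult_left_mono) (auto simp: indicator_def)
    have "?I top = top"
    proof (rule ccontr)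
      assume "?I top \<noteq> top"
      then obtain b where b: "?I top = ennreal b" "0 \<le> b" by (cases "?I top") auto
      \<comment> \<open>If the integral had a finite value \<open>b\<close>, truncating at the
        height whose power is \<open>b + 1\<close> would already exceed it.\<close>
      have "ennreal (((b + 1) powr (1 / a)) powr a) \<le> ennreal b"
        using le[of "(b + 1) powr (1 / a)"] b by simp
      then show False using b assms by (simp add: powr_powr)
    qed
    then show ?thesis using top by (simp add: enn_powr_top)
  qed
qed

text \<open>Fubini applied to \<open>enn_powr_eq_nn_integral\<close>. The weight \<open>v\<close>
  allows two uses in the strong type bound: \<open>v = 1\<close> with the maximal function, and
  \<open>v = f\<close> with \<open>2 * f\<close>.\<close>

lemma nn_integral_layer_cake:
  fixes u v :: "'a::euclidean_space \<Rightarrow> ennreal"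
  assumes [measurable]: "u \<in> borel_measurable borel" "v \<in> borel_measurable borel" and a: "0 < a"
  shows "(\<integral>\<^sup>+x. v x * enn_powr (u x) a \<partial>lborel) =
    (\<integral>\<^sup>+t. ennreal (a * t powr (a - 1)) * indicator {0<..} t *
      (\<integral>\<^sup>+x. v x * indicator {x. ennreal t < u x} x \<partial>lborel) \<partial>lborel)"
proof -
  have m: "(\<lambda>t. ennreal (a * t powr (a - 1)) * indicator {t. 0 < t \<and> ennreal t < u x} t) \<in> borel_measurable lborel" for x
    by measurable
  have "(\<integral>\<^sup>+x. v x * enn_powr (u x) a \<partial>lborel) =
    (\<integral>\<^sup>+x. (\<integral>\<^sup>+t. v x * (ennreal (a * t powr (a - 1)) * indicator {t. 0 < t \<and> ennreal t < u x} t) \<partial>lborel) \<partial>lborel)"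
    unfolding enn_powr_eq_nn_integral[OF a] using m by (simp add: nn_integral_cmult)
  also have "\<dots> = (\<integral>\<^sup>+x. (\<integral>\<^sup>+t. ennreal (a * t powr (a - 1)) * indicator {0<..} t *
      (v x * indicator {x. ennreal t < u x} x) \<partial>lborel) \<partial>lborel)"
    by (intro nn_integral_cong) (auto simp: indicator_def ac_simps)
  also have "\<dots> = (\<integral>\<^sup>+t. (\<integral>\<^sup>+x. ennreal (a * t powr (a - 1)) * indicator {0<..} t *
      (v x * indicator {x. ennreal t < u x} x) \<partial>lborel) \<partial>lborel)"
    by (rule lborel_pair.Fubini') (simp add: indicator_def case_prod_unfold, measurable)
  also have "\<dots> = (\<integral>\<^sup>+t. ennreal (a * t powr (a - 1)) * indicator {0<..} t *
      (\<integral>\<^sup>+x. v x * indicator {x. ennreal t < u x} x \<partial>lborel) \<partial>lborel)"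
    by (intro nn_integral_cong nn_integral_cmult) measurable
  finally show ?thesis .
qed

section \<open>The Hardy--Littlewood maximal operator\<close>

text \<open>The uncentred operator over open balls: its superlevel sets are unions of open balls, so
  \<open>maximal_fun f\<close> is Borel for every \<open>f\<close>.\<close>

definition maximal_fun :: "('a::euclidean_space \<Rightarrow> ennreal) \<Rightarrow> 'a \<Rightarrow> ennreal" where
  "maximal_fun f x = (SUP (a, r) \<in> {(a, r). 0 < r \<and> x \<in> ball a r}. cube_avg f (ball a r))"

lemma ball_in_borel [measurable]: "ball a r \<in> sets borel"
  by simp

lemma cube_avg_ball_mult:
  fixes a :: "'a::euclidean_space"
  assumes "0 < r"
  shows "cube_avg f (ball a r) * emeasure lborel (ball a r) = (\<integral>\<^sup>+x\<in>ball a r. f x \<partial>lborel)"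
proof -
  have "0 < unit_ball_vol (real DIM('a))" by simp
  then have "emeasure lborel (ball a r) \<noteq> 0" "emeasure lborel (ball a r) \<noteq> top"
    using assms by (auto simp: emeasure_ball simp del: unit_ball_vol_pos)
  then show ?thesis
    unfolding cube_avg_def by (simp add: ennreal_divide_times ennreal_times_divide[symmetric] less_top)
qed

lemma cube_avg_ball_le_maximal_fun:
  "0 < r \<Longrightarrow> x \<in> ball a r \<Longrightarrow> cube_avg f (ball a r) \<le> maximal_fun f x"
  unfolding maximal_fun_def by (rule SUP_upper2[of "(a, r)"]) auto

lemma less_maximal_fun_iff:
  "t < maximal_fun f x \<longleftrightarrow> (\<exists>a r. 0 < r \<and> x \<in> ball a r \<and> t < cube_avg f (ball a r))"
  unfolding maximal_fun_def less_SUP_iff by auto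

lemma borel_measurable_maximal_fun [measurable]: "maximal_fun f \<in> borel_measurable borel"
proof (rule borel_measurableI_greater)
  fix t
  have "{x \<in> space borel. t < maximal_fun f x} =
    (\<Union>(a, r)\<in>{(a, r). 0 < r \<and> t < cube_avg f (ball a r)}. ball a r)"
    by (rule set_eqI, simp add: less_maximal_fun_iff, metis)
  then show "{x \<in> space borel. t < maximal_fun f x} \<in> sets borel"
    by (auto intro!: borel_open)
qed

lemma cube_avg_mono: "(\<And>x. f x \<le> g x) \<Longrightarrow> cube_avg f Q \<le> cube_avg g Q"
  unfolding cube_avg_def by (intro divide_right_mono_ennreal nn_integral_mono mult_right_mono) auto

lemma maximal_fun_mono: "(\<And>x. f x \<le> g x) \<Longrightarrow> maximal_fun f x \<le> maximal_fun g x"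
  unfolding maximal_fun_def by (intro SUP_subset_mono) (auto intro!: cube_avg_mono)

text \<open>Monotone convergence on each ball separately, followed by exchanging two suprema. It
  carries the bounds on the iterates of the majorant construction over to their limit.\<close>

lemma maximal_fun_SUP_le:
  fixes f :: "nat \<Rightarrow> 'a::euclidean_space \<Rightarrow> ennreal"
  assumes "incseq f" and [measurable]: "\<And>k. f k \<in> borel_measurable borel"
  shows "maximal_fun (\<lambda>x. SUP k. f k x) x \<le> (SUP k. maximal_fun (f k) x)"
proof -
  have "cube_avg (\<lambda>x. SUP k. f k x) (ball a r) \<le> (SUP k. maximal_fun (f k) x)"
    if "0 < r" "x \<in> ball a r" for a r
  proof -
    have "(\<integral>\<^sup>+x\<in>ball a r. (SUP k. f k x) \<partial>lborel) = (\<integral>\<^sup>+x. (SUP k. f k x * indicator (ball a r) x) \<partial>lborel)"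
      by (simp add: SUP_mult_right_ennreal)
    also have "\<dots> = (SUP k. \<integral>\<^sup>+x\<in>ball a r. f k x \<partial>lborel)"
      using assms(1) by (intro nn_integral_monotone_convergence_SUP)
        (auto simp: incseq_def le_fun_def indicator_def)
    finally have "cube_avg (\<lambda>x. SUP k. f k x) (ball a r) = (SUP k. cube_avg (f k) (ball a r))"
      unfolding cube_avg_def by (simp add: SUP_divide_ennreal)
    also have "\<dots> \<le> (SUP k. maximal_fun (f k) x)"
      using that by (intro SUP_mono') (rule cube_avg_ball_le_maximal_fun)
    finally show ?thesis .
  qed
  then show ?thesis
    unfolding maximal_fun_def[of "\<lambda>x. SUP k. f k x"] by (auto intro!: SUP_least)
qed

text \<open>Vitali covering: among the given balls there are countably many disjoint ones whose
  fivefold dilates cover \<open>S\<close>. Dilation costs the factor \<open>5 ^ DIM('a)\<close>, and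
  disjointness makes the integrals of \<open>f\<close> over the selected balls sum to at most the
  whole integral.\<close>

lemma emeasure_le_of_ball_cover:
  fixes f :: "'a::euclidean_space \<Rightarrow> ennreal" and S :: "'a set"
  assumes f [measurable]: "f \<in> borel_measurable borel" and t: "0 < t"
    and cov: "\<And>x. x \<in> S \<Longrightarrow> \<exists>a r. 0 < r \<and> x \<in> ball a r \<and>
      ennreal t * emeasure lborel (ball a r) \<le> (\<integral>\<^sup>+y\<in>ball a r. f y \<partial>lborel)"
  shows "ennreal t * emeasure lborel S \<le> 5 ^ DIM('a) * (\<integral>\<^sup>+x. f x \<partial>lborel)"
proof (cases "(\<integral>\<^sup>+x. f x \<partial>lborel) = top")
  case True
  then show ?thesis by (simp add: ennreal_mult_top)
next
  case False
  let ?d = "DIM('a)"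
  let ?v = "unit_ball_vol (real ?d)"
  define K where "K = {(a, r). 0 < r \<and>
    ennreal t * emeasure lborel (ball a r) \<le> (\<integral>\<^sup>+y\<in>ball (a::'a) r. f y \<partial>lborel)}"
  obtain I where I: "(\<integral>\<^sup>+x. f x \<partial>lborel) = ennreal I" "0 \<le> I"
    using False by (cases "\<integral>\<^sup>+x. f x \<partial>lborel") auto
  have v: "0 < ?v" by simp
  \<comment> \<open>The covering lemma needs bounded radii. An admissible ball of radius
    \<open>r > 1\<close> satisfies \<open>t * ?v * r <= t * ?v * r ^ ?d <= I\<close>, which bounds
    \<open>r\<close>.\<close>
  define B where "B = max 1 (I / (t * ?v))"
  have "snd i \<le> B" if "i \<in> K" for i
  proof (cases "snd i \<le> 1")
    case False
    obtain a r where i: "i = (a, r)" by (cases i)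
    with that False have r: "1 < r"
      and "ennreal t * emeasure lborel (ball a r) \<le> (\<integral>\<^sup>+y\<in>ball a r. f y \<partial>lborel)"
      by (auto simp: K_def)
    moreover have "(\<integral>\<^sup>+y\<in>ball a r. f y \<partial>lborel) \<le> (\<integral>\<^sup>+y. f y \<partial>lborel)"
      by (intro nn_integral_mono) (auto simp: indicator_def)
    ultimately have "ennreal (t * (?v * r ^ ?d)) \<le> ennreal I"
      using I t by (simp add: emeasure_ball ennreal_mult')
    then have "t * (?v * r ^ ?d) \<le> I" using I by simp
    moreover have "r \<le> r ^ ?d" using r by (intro self_le_power) auto
    then have "t * (?v * r) \<le> t * (?v * r ^ ?d)"
      using t v by (intro mult_left_mono) auto
    ultimately have "r * (t * ?v) \<le> I" by (simp add: mult_ac)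
    then show ?thesis using t v by (simp add: i B_def pos_le_divide_eq le_max_iff_disj)
  qed (simp add: B_def)
  then have KB: "0 < snd i \<and> snd i \<le> B" if "i \<in> K" for i
    using that by (auto simp: K_def)
  have "S \<subseteq> (\<Union>i\<in>K. ball (fst i) (snd i))"
  proof
    fix x assume "x \<in> S"
    from cov[OF this] obtain a r where "(a, r) \<in> K" "x \<in> ball a r" by (auto simp: K_def)
    then show "x \<in> (\<Union>i\<in>K. ball (fst i) (snd i))" by force
  qed
  then obtain C where C: "countable C" "C \<subseteq> K"
    and disj: "pairwise (\<lambda>i j. disjnt (ball (fst i) (snd i)) (ball (fst j) (snd j))) C"
    and S: "S \<subseteq> (\<Union>i\<in>C. ball (fst i) (5 * snd i))"
    using KB by (rule Vitali_covering_lemma_balls)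
  have "emeasure lborel S \<le> emeasure lborel (\<Union>i\<in>C. ball (fst i) (5 * snd i))"
    using C S by (intro emeasure_mono) auto
  also have "\<dots> = (\<integral>\<^sup>+x. indicator (\<Union>i\<in>C. ball (fst i) (5 * snd i)) x \<partial>lborel)"
    using C by (intro nn_integral_indicator[symmetric]) auto
  \<comment> \<open>Countable subadditivity, with the sum over \<open>C\<close> written as an
    integral for the counting measure so that the two integrals can be exchanged.\<close>
  also have "\<dots> \<le> (\<integral>\<^sup>+x. (\<integral>\<^sup>+i. indicator (ball (fst i) (5 * snd i)) x \<partial>count_space C) \<partial>lborel)"
  proof (intro nn_integral_mono)
    fix x
    show "indicator (\<Union>i\<in>C. ball (fst i) (5 * snd i)) x \<le>
      (\<integral>\<^sup>+i. indicator (ball (fst i) (5 * snd i)) x \<partial>count_space C)"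
    proof (cases "x \<in> (\<Union>i\<in>C. ball (fst i) (5 * snd i))")
      case True
      then obtain i where i: "i \<in> C" "x \<in> ball (fst i) (5 * snd i)" by auto
      have "indicator (ball (fst i) (5 * snd i)) x \<le>
        (\<integral>\<^sup>+i. indicator (ball (fst i) (5 * snd i)) x \<partial>count_space C)"
        using i(1) by (rule nn_integral_ge_point)
      then show ?thesis using i by (auto simp: indicator_def)
    qed simp
  qed
  also have "\<dots> = (\<integral>\<^sup>+i. emeasure lborel (ball (fst i) (5 * snd i)) \<partial>count_space C)"
    using C(1) by (subst nn_integral_count_space_nn_integral) (simp_all, measurable)
  finally have "ennreal t * emeasure lborel S \<le>
    ennreal t * (\<integral>\<^sup>+i. emeasure lborel (ball (fst i) (5 * snd i)) \<partial>count_space C)"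
    by (rule mult_left_mono) simp
  also have "\<dots> = (\<integral>\<^sup>+i. ennreal t * emeasure lborel (ball (fst i) (5 * snd i)) \<partial>count_space C)"
    by (simp add: nn_integral_cmult)
  \<comment> \<open>Integrals of \<open>f\<close> are regarded as values of the measure with density
    \<open>f\<close>, to which countable additivity over the disjoint balls applies.\<close>
  also have "\<dots> \<le> (\<integral>\<^sup>+i. 5 ^ ?d * emeasure (density lborel f) (ball (fst i) (snd i)) \<partial>count_space C)"
  proof (intro nn_integral_mono)
    fix i assume "i \<in> space (count_space C)"
    then have i: "i \<in> K" using C by auto
    then have r: "0 < snd i" by (auto simp: K_def)
    have "ennreal t * emeasure lborel (ball (fst i) (5 * snd i)) =
      5 ^ ?d * (ennreal t * emeasure lborel (ball (fst i) (snd i)))"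
    proof -
      have "emeasure lborel (ball (fst i) (5 * snd i)) = ennreal (5 ^ ?d * (?v * snd i ^ ?d))"
        using r by (simp add: emeasure_ball power_mult_distrib mult.left_commute)
      also have "\<dots> = ennreal (5 ^ ?d) * emeasure lborel (ball (fst i) (snd i))"
        using r by (simp add: emeasure_ball ennreal_mult')
      also have "ennreal (5 ^ ?d) = 5 ^ ?d"
        by (simp flip: ennreal_power)
      finally show ?thesis by (simp only: mult.left_commute)
    qed
    also have "\<dots> \<le> 5 ^ ?d * emeasure (density lborel f) (ball (fst i) (snd i))"
      using i by (intro mult_left_mono) (auto simp: K_def emeasure_density)
    finally show "ennreal t * emeasure lborel (ball (fst i) (5 * snd i)) \<le>
      5 ^ ?d * emeasure (density lborel f) (ball (fst i) (snd i))" .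
  qed
  also have "\<dots> = 5 ^ ?d * (\<integral>\<^sup>+i. emeasure (density lborel f) (ball (fst i) (snd i)) \<partial>count_space C)"
    by (simp add: nn_integral_cmult)
  also have "(\<integral>\<^sup>+i. emeasure (density lborel f) (ball (fst i) (snd i)) \<partial>count_space C) =
    emeasure (density lborel f) (\<Union>i\<in>C. ball (fst i) (snd i))"
    using C disj by (intro emeasure_UN_countable[symmetric])
      (auto simp: disjoint_family_on_def pairwise_def disjnt_def)
  also have "\<dots> \<le> emeasure (density lborel f) UNIV"
    by (intro emeasure_mono) auto
  also have "\<dots> = (\<integral>\<^sup>+x. f x \<partial>lborel)"
    by (simp add: emeasure_density)
  finally show ?thesis by (meson mult_left_mono zero_le)
qed

text \<open>The part of \<open>f\<close> where \<open>2 * f <= t\<close> contributes at most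
  \<open>t / 2\<close> to any average. A ball on which \<open>f\<close> averages more than
  \<open>t\<close> thus has average at least \<open>t / 2\<close> for the remaining part, and the
  covering bound applies at level \<open>t / 2\<close>. Keeping only the large values of
  \<open>f\<close> on the right is what makes the estimate integrable in \<open>t\<close>
  afterwards.\<close>

lemma maximal_fun_weak_type:
  fixes f :: "'a::euclidean_space \<Rightarrow> ennreal"
  assumes f [measurable]: "f \<in> borel_measurable borel" and t: "0 < t"
  shows "ennreal t * emeasure lborel {x. ennreal t < maximal_fun f x} \<le>
    2 * 5 ^ DIM('a) * (\<integral>\<^sup>+x. f x * indicator {x. ennreal t < 2 * f x} x \<partial>lborel)"
proof -
  let ?h = "\<lambda>x. f x * indicator {x. ennreal t < 2 * f x} x"
  have split: "f x \<le> ?h x + ennreal (t / 2)" for x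
  proof (cases "ennreal t < 2 * f x")
    case False
    then have "2 * f x \<le> 2 * ennreal (t / 2)"
      using t ennreal_mult'[of 2 "t / 2"] by simp
    then have "f x \<le> ennreal (t / 2)" by (simp add: ennreal_mult_le_mult_iff)
    then show ?thesis by (simp add: add_increasing)
  qed simp
  have "ennreal (t / 2) * emeasure lborel {x. ennreal t < maximal_fun f x} \<le>
    5 ^ DIM('a) * (\<integral>\<^sup>+x. ?h x \<partial>lborel)"
  proof (rule emeasure_le_of_ball_cover)
    fix x assume "x \<in> {x. ennreal t < maximal_fun f x}"
    then obtain a r where r: "0 < r" "x \<in> ball a r" and avg: "ennreal t < cube_avg f (ball a r)"
      by (auto simp: less_maximal_fun_iff)
    let ?B = "ball a r" and ?b = "ennreal (t / 2) * emeasure lborel (ball a r)"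
    \<comment> \<open>Finiteness permits cancelling one copy of \<open>?b\<close> at the end of the
      chain.\<close>
    have fin: "?b \<noteq> top" by (use r in \<open>simp add: emeasure_ball ennreal_mult_eq_top_iff\<close>)
    have "?b + ?b = ennreal t * emeasure lborel ?B"
      using t by (simp add: distrib_right[symmetric] flip: ennreal_plus)
    also have "\<dots> \<le> cube_avg f ?B * emeasure lborel ?B"
      using avg by (intro mult_right_mono) auto
    also have "\<dots> = (\<integral>\<^sup>+y\<in>?B. f y \<partial>lborel)"
      using r by (simp add: cube_avg_ball_mult)
    also have "\<dots> \<le> (\<integral>\<^sup>+y. ?h y * indicator ?B y + ennreal (t / 2) * indicator ?B y \<partial>lborel)"
    proof (intro nn_integral_mono)
      fix y show "f y * indicator ?B y \<le> ?h y * indicator ?B y + ennreal (t / 2) * indicator ?B y"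
        using mult_right_mono[OF split[of y], of "indicator ?B y"] by (simp add: distrib_right)
    qed
    also have "\<dots> = (\<integral>\<^sup>+y\<in>?B. ?h y \<partial>lborel) + ?b"
      by (subst nn_integral_add) (simp_all add: nn_integral_cmult)
    finally have "?b \<le> (\<integral>\<^sup>+y\<in>?B. ?h y \<partial>lborel)"
      using fin by (simp add: add.commute ennreal_add_left_cancel_le)
    then show "\<exists>a r. 0 < r \<and> x \<in> ball a r \<and>
      ennreal (t / 2) * emeasure lborel (ball a r) \<le> (\<integral>\<^sup>+y\<in>ball a r. ?h y \<partial>lborel)"
      using r by blast
  qed (use t in auto)
  then have "2 * (ennreal (t / 2) * emeasure lborel {x. ennreal t < maximal_fun f x}) \<le>
    2 * (5 ^ DIM('a) * (\<integral>\<^sup>+x. ?h x \<partial>lborel))"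
    by (rule mult_left_mono) simp
  moreover have "2 * ennreal (t / 2) = ennreal t"
    using t ennreal_mult'[of 2 "t / 2"] by simp
  ultimately show ?thesis by (simp add: mult.assoc[symmetric])
qed

lemma enn_powr_add_one: "x * enn_powr x r = enn_powr x (r + 1)"
proof (cases x)
  case (real c)
  then have "c * c powr r = c powr (r + 1)" by (simp add: powr_mult_base add.commute)
  with real show ?thesis by (simp add: enn_powr_ennreal flip: ennreal_mult)
qed (simp add: enn_powr_top)

text \<open>Marcinkiewicz interpolation: the weak type estimate is integrated over all levels by the
  layer-cake formula. The blow-up \<open>1 / (p - 1)\<close> comes from integrating
  \<open>t powr (p - 2)\<close> near 0, and it determines both exponents in the theorem; the rest of
  the constant is bounded using \<open>p <= 2\<close>.\<close>

lemma maximal_fun_strong_type: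
  fixes f :: "'a::euclidean_space \<Rightarrow> ennreal"
  assumes f [measurable]: "f \<in> borel_measurable borel" and p: "1 < p" "p \<le> 2"
  shows "(\<integral>\<^sup>+x. enn_powr (maximal_fun f x) p \<partial>lborel) \<le>
    ennreal (8 * 5 ^ DIM('a) / (p - 1)) * (\<integral>\<^sup>+x. enn_powr (f x) p \<partial>lborel)"
proof -
  let ?C = "2 * 5 ^ DIM('a) :: ennreal"
  let ?J = "\<lambda>t. \<integral>\<^sup>+x. f x * indicator {x. ennreal t < 2 * f x} x \<partial>lborel"
  have [measurable]: "(\<lambda>t. ?J t) \<in> borel_measurable borel"
    unfolding indicator_def by measurable
  have "(\<integral>\<^sup>+x. enn_powr (maximal_fun f x) p \<partial>lborel) =
    (\<integral>\<^sup>+t. ennreal (p * t powr (p - 1)) * indicator {0<..} t *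
      emeasure lborel {x. ennreal t < maximal_fun f x} \<partial>lborel)"
    using nn_integral_layer_cake[of "maximal_fun f" "\<lambda>_. 1" p] p by simp
  \<comment> \<open>One factor \<open>t\<close> is spent on the weak type estimate. The remaining
    density is normalised to that of the exponent \<open>p - 1\<close>, so that the layer-cake
    formula can be read backwards for \<open>2 * f\<close> with weight \<open>f\<close>.\<close>
  also have "\<dots> \<le> (\<integral>\<^sup>+t. (ennreal (p / (p - 1)) * ?C) *
      (ennreal ((p - 1) * t powr (p - 1 - 1)) * indicator {0<..} t * ?J t) \<partial>lborel)"
  proof (intro nn_integral_mono)
    fix t :: real
    show "ennreal (p * t powr (p - 1)) * indicator {0<..} t * emeasure lborel {x. ennreal t < maximal_fun f x}
      \<le> (ennreal (p / (p - 1)) * ?C) * (ennreal ((p - 1) * t powr (p - 1 - 1)) * indicator {0<..} t * ?J t)"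
    proof (cases "0 < t")
      case True
      have "t powr (p - 1) = t powr (p - 2) * t"
        using True powr_add[of t "p - 2" 1] by simp
      then have "ennreal (p * t powr (p - 1)) = ennreal (p * t powr (p - 2)) * ennreal t"
        using True p by (simp add: mult_ac flip: ennreal_mult)
      then have "ennreal (p * t powr (p - 1)) * indicator {0<..} t * emeasure lborel {x. ennreal t < maximal_fun f x} =
        ennreal (p * t powr (p - 2)) * (ennreal t * emeasure lborel {x. ennreal t < maximal_fun f x})"
        using True by (simp add: mult.assoc)
      also have "\<dots> \<le> ennreal (p * t powr (p - 2)) * (?C * ?J t)"
        using True by (intro mult_left_mono maximal_fun_weak_type) auto
      also have "ennreal (p * t powr (p - 2)) = ennreal (p / (p - 1)) * ennreal ((p - 1) * t powr (p - 1 - 1))"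
        using p by (simp flip: ennreal_mult)
      also have "\<dots> * (?C * ?J t) = (ennreal (p / (p - 1)) * ?C) *
          (ennreal ((p - 1) * t powr (p - 1 - 1)) * indicator {0<..} t * ?J t)"
        using True by (simp only: mult_ac indicator_simps greaterThan_iff mult_1)
      finally show ?thesis .
    qed simp
  qed
  also have "\<dots> = (ennreal (p / (p - 1)) * ?C) * (\<integral>\<^sup>+t. 
      (ennreal ((p - 1) * t powr (p - 1 - 1)) * indicator {0<..} t * ?J t) \<partial>lborel)"
    by (rule nn_integral_cmult) measurable
  also have "\<dots> = (ennreal (p / (p - 1)) * ?C) * (\<integral>\<^sup>+x. f x * enn_powr (2 * f x) (p - 1) \<partial>lborel)"
    using nn_integral_layer_cake[of "\<lambda>x. 2 * f x" f "p - 1"] p by simp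
  also have "(\<lambda>x. f x * enn_powr (2 * f x) (p - 1)) = (\<lambda>x. ennreal (2 powr (p - 1)) * enn_powr (f x) p)"
  proof
    fix x
    have "f x * enn_powr (2 * f x) (p - 1) = enn_powr 2 (p - 1) * (f x * enn_powr (f x) (p - 1))"
      using p by (simp add: enn_powr_mult mult_ac)
    also have "enn_powr 2 (p - 1) = ennreal (2 powr (p - 1))"
      using enn_powr_ennreal[of 2] by simp
    finally show "f x * enn_powr (2 * f x) (p - 1) = ennreal (2 powr (p - 1)) * enn_powr (f x) p"
      using p by (simp add: enn_powr_add_one)
  qed
  also have "(\<integral>\<^sup>+x. ennreal (2 powr (p - 1)) * enn_powr (f x) p \<partial>lborel) =
    ennreal (2 powr (p - 1)) * (\<integral>\<^sup>+x. enn_powr (f x) p \<partial>lborel)"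
    by (rule nn_integral_cmult) measurable
  also have "ennreal (p / (p - 1)) * ?C * (ennreal (2 powr (p - 1)) * (\<integral>\<^sup>+x. enn_powr (f x) p \<partial>lborel)) =
    ennreal (p / (p - 1) * (2 * 5 ^ DIM('a)) * 2 powr (p - 1)) * (\<integral>\<^sup>+x. enn_powr (f x) p \<partial>lborel)"
    using p by (simp add: ennreal_mult' mult.assoc ennreal_power del: times_divide_eq_left flip: ennreal_numeral)
  also have "\<dots> \<le> ennreal (8 * 5 ^ DIM('a) / (p - 1)) * (\<integral>\<^sup>+x. enn_powr (f x) p \<partial>lborel)"
  proof (intro mult_right_mono ennreal_leI)
    have "(2::real) powr (p - 1) \<le> 2 powr 1" using p by (intro powr_mono) auto
    then have "p * 2 powr (p - 1) \<le> 2 * 2" using p by (intro mult_mono) auto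
    then have "p * 2 powr (p - 1) * (2 * 5 ^ DIM('a)) \<le> 4 * (2 * 5 ^ DIM('a))"
      by (intro mult_right_mono) auto
    then show "p / (p - 1) * (2 * 5 ^ DIM('a)) * 2 powr (p - 1) \<le> 8 * 5 ^ DIM('a) / (p - 1)"
      using p by (simp add: pos_le_divide_eq mult_ac)
  qed simp
  finally show ?thesis .
qed

section \<open>Majorants in \<open>A\<^sub>1\<close>\<close>

lemma ennreal_mean_mono:
  fixes x y z u :: ennreal
  shows "x \<le> z \<Longrightarrow> y \<le> u \<Longrightarrow> (x + y) / 2 \<le> (z + u) / 2"
  by (intro divide_right_mono_ennreal add_mono)

lemma ennreal_le_two_mean:
  fixes x y :: ennreal
  shows "x \<le> 2 * ((x + y) / 2)" "y \<le> 2 * ((x + y) / 2)"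
proof -
  have "2 * ((x + y) / 2) = x + y"
    using mult_divide_eq_ennreal[of 2 "x + y"] by (simp only: ennreal_times_divide mult.commute) simp
  then show "x \<le> 2 * ((x + y) / 2)" "y \<le> 2 * ((x + y) / 2)"
    by (simp_all add: add_increasing add_increasing2)
qed

text \<open>The majorant is the least fixed point of \<open>g \<mapsto> (f + M g / N) / 2\<close>, where \<open>N\<close> bounds the
  maximal operator \<open>M\<close> on \<open>L\<^sup>p\<close>. Convexity of the power keeps the iterates in the \<open>L\<^sup>p\<close> ball of \<open>f\<close>.\<close>

lemma A1_majorant_ennreal:
  fixes f :: "'a::euclidean_space \<Rightarrow> ennreal"
  assumes f [measurable]: "f \<in> borel_measurable borel" and p: "1 < p" "p \<le> 2"
  obtains g where "g \<in> borel_measurable borel" "\<And>x. f x \<le> 2 * g x"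
    "\<And>x. maximal_fun g x \<le> ennreal (16 * 5 ^ DIM('a) / (p - 1)) * g x"
    "(\<integral>\<^sup>+x. enn_powr (g x) p \<partial>lborel) \<le> (\<integral>\<^sup>+x. enn_powr (f x) p \<partial>lborel)"
proof -
  define N :: real where "N = 8 * 5 ^ DIM('a) / (p - 1)"
  have "(1::real) \<le> 5 ^ DIM('a)" by simp
  then have "p - 1 \<le> 8 * 5 ^ DIM('a)" using p by linarith
  then have N: "1 \<le> N" using p by (simp add: N_def)
  define step where "step = (\<lambda>g x. (f x + ennreal (1 / N) * maximal_fun g x) / 2)"
  define G where "G = (\<lambda>k. (step ^^ k) (\<lambda>_. 0))"
  define g where "g = (\<lambda>x. SUP k. G k x)"
  have G_Suc: "G (Suc k) = step (G k)" for k
    by (simp add: G_def)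
  have step_mono: "step u x \<le> step v x" if "\<And>x. u x \<le> v x" for u v x
    unfolding step_def using that
    by (intro ennreal_mean_mono mult_left_mono maximal_fun_mono) auto
  \<comment> \<open>The iteration starts at 0 and the step is monotone, so the iterates increase;
    monotone convergence then applies to their supremum.\<close>
  have G_le: "G k x \<le> G (Suc k) x" for k x
  proof (induction k arbitrary: x)
    case 0
    show ?case by (simp add: G_def)
  next
    case (Suc k)
    then show ?case unfolding G_Suc[of k] G_Suc[of "Suc k"] by (rule step_mono)
  qed
  then have inc: "incseq G" by (auto intro!: incseq_SucI simp: le_fun_def)
  have G_meas [measurable]: "G k \<in> borel_measurable borel" for k
  proof (cases k)
    case 0
    then show ?thesis by (simp add: G_def)
  next
    case (Suc j)
    then show ?thesis unfolding Suc G_Suc step_def by measurable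
  qed
  let ?I = "\<lambda>u :: 'a \<Rightarrow> ennreal. \<integral>\<^sup>+x. enn_powr (u x) p \<partial>lborel"
  have G_int: "?I (G k) \<le> ?I f" for k
  proof (induction k)
    case 0
    show ?case using p by (simp add: G_def enn_powr_def)
  next
    case (Suc k)
    have "?I (\<lambda>x. ennreal (1 / N) * maximal_fun (G k) x) =
      ennreal ((1 / N) powr p) * ?I (maximal_fun (G k))"
      using p N by (simp add: enn_powr_mult enn_powr_ennreal nn_integral_cmult)
    also have "\<dots> \<le> ennreal ((1 / N) powr p) * (ennreal N * ?I (G k))"
      using p unfolding N_def by (intro mult_left_mono maximal_fun_strong_type) auto
    also have "\<dots> = ennreal ((1 / N) powr p * N) * ?I (G k)"
      using N by (simp add: ennreal_mult' mult.assoc)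
    \<comment> \<open>\<open>N\<close> bounds integrals of p-th powers, while dividing the maximal
      function by \<open>N\<close> gains \<open>N powr - p\<close>. Since \<open>N >= 1\<close> and
      \<open>p > 1\<close>, the gain absorbs the loss.\<close>
    also have "\<dots> \<le> 1 * ?I (G k)"
    proof (intro mult_right_mono)
      have "(1 / N) powr p \<le> (1 / N) powr 1"
        using N p by (intro powr_mono') auto
      then have "(1 / N) powr p * N \<le> 1 / N * N"
        using N by (intro mult_right_mono) auto
      then show "ennreal ((1 / N) powr p * N) \<le> 1" using N by simp
    qed simp
    also have "\<dots> \<le> ?I f" using Suc by simp
    finally have M: "?I (\<lambda>x. ennreal (1 / N) * maximal_fun (G k) x) \<le> ?I f" .
    have "?I (G (Suc k)) \<le> (\<integral>\<^sup>+x. (enn_powr (f x) p + enn_powr (ennreal (1 / N) * maximal_fun (G k) x) p) / 2 \<partial>lborel)"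
      unfolding G_Suc step_def using p by (intro nn_integral_mono enn_powr_mean_le) auto
    also have "\<dots> = (?I f + ?I (\<lambda>x. ennreal (1 / N) * maximal_fun (G k) x)) / 2"
      by (simp add: nn_integral_divide nn_integral_add)
    also have "\<dots> \<le> (?I f + ?I f) / 2"
      using M by (intro ennreal_mean_mono) auto
    also have "\<dots> = ?I f"
      by (simp add: mult_2[symmetric] ennreal_times_divide[symmetric] mult.commute[of 2] mult_divide_eq_ennreal)
    finally show ?case .
  qed
  show ?thesis
  proof
    show "g \<in> borel_measurable borel" unfolding g_def by measurable
    show "f x \<le> 2 * g x" for x
    proof -
      have "f x \<le> 2 * G 1 x"
        using G_Suc[of 0] ennreal_le_two_mean(1) by (simp add: step_def)
      also have "G 1 x \<le> g x" unfolding g_def by (rule SUP_upper) simp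
      finally show ?thesis by (simp add: mult_left_mono)
    qed
    show "maximal_fun g x \<le> ennreal (16 * 5 ^ DIM('a) / (p - 1)) * g x" for x
    proof -
      have "maximal_fun (G k) x \<le> ennreal (2 * N) * g x" for k
      proof -
        \<comment> \<open>The maximal function of one iterate is controlled by the next iterate,
          hence by the supremum; this yields the constant \<open>2 * N\<close>.\<close>
        have "ennreal (1 / N) * maximal_fun (G k) x \<le> 2 * G (Suc k) x"
          unfolding G_Suc step_def by (rule ennreal_le_two_mean(2))
        also have "\<dots> \<le> 2 * g x"
          unfolding g_def by (intro mult_left_mono SUP_upper) auto
        finally have "ennreal N * (ennreal (1 / N) * maximal_fun (G k) x) \<le> ennreal N * (2 * g x)"
          by (rule mult_left_mono) simp
        moreover have "ennreal N * ennreal (1 / N) = 1"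
          using N by (simp flip: ennreal_mult)
        ultimately show ?thesis
          using N by (simp add: mult.assoc[symmetric] ennreal_mult') (simp add: mult.commute)
      qed
      then have "(SUP k. maximal_fun (G k) x) \<le> ennreal (2 * N) * g x"
        by (rule SUP_least)
      moreover have "maximal_fun g x \<le> (SUP k. maximal_fun (G k) x)"
        unfolding g_def using inc by (intro maximal_fun_SUP_le) auto
      ultimately show ?thesis by (simp add: N_def)
    qed
    have "?I g \<le> (\<integral>\<^sup>+x. (SUP k. enn_powr (G k x) p) \<partial>lborel)"
      unfolding g_def using p by (intro nn_integral_mono enn_powr_SUP_le) auto
    also have "\<dots> = (SUP k. ?I (G k))"
      using inc p by (intro nn_integral_monotone_convergence_SUP)
        (auto simp: incseq_def le_fun_def intro!: enn_powr_mono)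
    also have "\<dots> \<le> ?I f" using G_int by (rule SUP_least)
    finally show "?I g \<le> ?I f" .
  qed
qed

section \<open>From balls to cubes, and real-valued majorants\<close>

lemma is_cubeE:
  assumes "is_cube (Q :: 'a::euclidean_space set)"
  obtains a r where "0 < r" "Q = cbox a (a + r *\<^sub>R One)" "emeasure lborel Q = ennreal (r ^ DIM('a))"
proof -
  from assms obtain a r where r: "0 < r" "Q = cbox a (a + r *\<^sub>R One)"
    by (auto simp: is_cube_def)
  then have "emeasure lborel Q = ennreal (r ^ DIM('a))"
    by (simp add: emeasure_lborel_cbox_eq inner_add_left inner_diff_left)
  with r show ?thesis by (rule that)
qed

lemma is_cube_measurable [measurable_dest]: "is_cube Q \<Longrightarrow> Q \<in> sets borel"
  by (auto simp: is_cube_def)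

lemma emeasure_is_cube:
  assumes "is_cube Q"
  shows "emeasure lborel Q \<noteq> 0" "emeasure lborel Q \<noteq> top" "emeasure lborel Q < top"
  using assms by (auto elim!: is_cubeE simp: less_top)

lemma cube_avg_leI:
  assumes "is_cube Q" "(\<integral>\<^sup>+x\<in>Q. f x \<partial>lborel) \<le> c * emeasure lborel Q"
  shows "cube_avg f Q \<le> c"
  using divide_right_mono_ennreal[OF assms(2), of "emeasure lborel Q"] emeasure_is_cube[OF assms(1)]
  by (simp add: cube_avg_def mult_divide_eq_ennreal)

text \<open>A cube of side \<open>r\<close> lies in the ball about its corner of radius
  \<open>2 * DIM('a) * r\<close>, and the constant is the ratio of the two volumes. The factor 2
  makes the norm estimate strict, as the ball is open.\<close>

lemma cube_avg_le_maximal_fun: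
  fixes f :: "'a::euclidean_space \<Rightarrow> ennreal"
  assumes Q: "is_cube Q" and x: "x \<in> Q"
  shows "cube_avg f Q \<le> ennreal (unit_ball_vol (real DIM('a)) * (2 * real DIM('a)) ^ DIM('a)) * maximal_fun f x"
proof -
  let ?d = "DIM('a)" and ?v = "unit_ball_vol (real DIM('a))"
  obtain a r where r: "0 < r" and Q_eq: "Q = cbox a (a + r *\<^sub>R One)"
    and em: "emeasure lborel Q = ennreal (r ^ ?d)"
    using Q by (rule is_cubeE)
  let ?R = "2 * real ?d * r"
  have sub: "Q \<subseteq> ball a ?R"
  proof
    fix y assume y: "y \<in> Q"
    have "norm (y - a) \<le> (\<Sum>b\<in>Basis. \<bar>(y - a) \<bullet> b\<bar>)" by (rule norm_le_l1)
    also have "\<dots> \<le> (\<Sum>b\<in>(Basis::'a set). r)"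
      using y by (intro sum_mono) (auto simp: Q_eq mem_box inner_add_left inner_diff_left)
    also have "\<dots> < ?R" using r by simp
    finally show "y \<in> ball a ?R" by (simp add: dist_norm norm_minus_commute)
  qed
  have R: "0 < ?R" using r by simp
  have "(\<integral>\<^sup>+x\<in>Q. f x \<partial>lborel) \<le> (\<integral>\<^sup>+x\<in>ball a ?R. f x \<partial>lborel)"
    using sub by (intro nn_integral_mono mult_left_mono) (auto simp: indicator_def)
  also have "\<dots> = cube_avg f (ball a ?R) * emeasure lborel (ball a ?R)"
    using R by (simp only: cube_avg_ball_mult)
  also have "\<dots> \<le> maximal_fun f x * emeasure lborel (ball a ?R)"
    using R x sub by (intro mult_right_mono cube_avg_ball_le_maximal_fun) auto
  also have "emeasure lborel (ball a ?R) = ennreal (?v * (2 * real ?d) ^ ?d) * emeasure lborel Q"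
    using r by (simp add: emeasure_ball em power_mult_distrib mult.assoc flip: ennreal_mult)
  finally show ?thesis
    using Q by (intro cube_avg_leI) (simp_all add: mult_ac)
qed

text \<open>The exceptional null set does not depend on the cube, as in the usual condition that the
  maximal function is at most \<open>K * g\<close> almost everywhere. Positivity at every point
  keeps negative powers of \<open>g\<close> meaningful.\<close>

definition A1_weight :: "real \<Rightarrow> ('a::euclidean_space \<Rightarrow> real) \<Rightarrow> bool" where
  "A1_weight K g \<longleftrightarrow> 0 < K \<and> g \<in> borel_measurable borel \<and> (\<forall>x. 0 < g x) \<and>
     (AE x in lborel. \<forall>Q. is_cube Q \<and> x \<in> Q \<longrightarrow> cube_avg (\<lambda>y. ennreal (g y)) Q \<le> ennreal (K * g x))"

text \<open>Such an \<open>h\<close> is added to a given function to keep its majorant away from 0.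
  As \<open>0 < h <= 1\<close> gives \<open>h powr p <= h\<close>, the same \<open>h\<close> serves
  all exponents \<open>p >= 1\<close>.\<close>

lemma positive_integrable_function:
  obtains h :: "'a::euclidean_space \<Rightarrow> real" where "h \<in> borel_measurable borel"
    "\<And>x. 0 < h x" "\<And>x. h x \<le> 1" "(\<integral>\<^sup>+x. ennreal (h x) \<partial>lborel) \<le> 1"
proof -
  obtain u :: "'a \<Rightarrow> ennreal" where u [measurable]: "u \<in> borel_measurable borel"
    and fin: "integral\<^sup>N lborel u \<noteq> \<infinity>" and pos: "\<And>x. 0 < u x \<and> u x < \<infinity>"
    using sigma_finite_measure.Ex_finite_integrable_function[OF sigma_finite_lborel] by fastforce
  obtain I where I: "integral\<^sup>N lborel u = ennreal I" "0 \<le> I"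
    using fin by (cases "integral\<^sup>N lborel u") auto
  define h where "h = (\<lambda>x. min 1 (enn2real (u x)) / (1 + I))"
  show ?thesis
  proof
    show "h \<in> borel_measurable borel" unfolding h_def by measurable
    show "0 < h x" for x
      using pos[of x] I by (auto simp: h_def enn2real_positive_iff)
    show "h x \<le> 1" for x
      using I by (auto simp: h_def min_def)
    have "ennreal (h x) \<le> ennreal (1 / (1 + I)) * u x" for x
    proof -
      have "h x \<le> 1 / (1 + I) * enn2real (u x)"
        using I by (auto simp: h_def divide_right_mono)
      then have "ennreal (h x) \<le> ennreal (1 / (1 + I)) * ennreal (enn2real (u x))"
        using I by (simp flip: ennreal_mult)
      then show ?thesis using pos[of x] by simp
    qed
    then have "(\<integral>\<^sup>+x. ennreal (h x) \<partial>lborel) \<le> (\<integral>\<^sup>+x. ennreal (1 / (1 + I)) * u x \<partial>lborel)"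
      by (rule nn_integral_mono)
    also have "\<dots> = ennreal (1 / (1 + I) * I)"
      using I by (simp add: nn_integral_cmult flip: ennreal_mult)
    also have "\<dots> \<le> 1" using I by simp
    finally show "(\<integral>\<^sup>+x. ennreal (h x) \<partial>lborel) \<le> 1" .
  qed
qed

text \<open>The volume ratio from \<open>cube_avg_le_maximal_fun\<close> times the numerator of the
  constant in \<open>A1_majorant_ennreal\<close>.\<close>

definition A1_dim_const :: "'a::euclidean_space itself \<Rightarrow> real" where
  "A1_dim_const _ = unit_ball_vol (real DIM('a)) * (2 * real DIM('a)) ^ DIM('a) * (16 * 5 ^ DIM('a))"

lemma A1_dim_const_pos: "0 < A1_dim_const TYPE('a::euclidean_space)"
  by (simp add: A1_dim_const_def)

text \<open>The extended-valued majorant is built for the mean of \<open>\<bar>f\<bar>\<close> and a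
  positive \<open>h\<close>; by convexity this mean stays in the unit ball. The factor 4 is 2 for
  taking the mean times 2 from the majorant.\<close>

lemma A1_majorant:
  fixes f :: "'a::euclidean_space \<Rightarrow> real"
  assumes f [measurable]: "f \<in> borel_measurable borel" and p: "1 < p" "p \<le> 2"
    and int: "(\<integral>\<^sup>+x. ennreal (\<bar>f x\<bar> powr p) \<partial>lborel) \<le> 1"
  obtains g where "A1_weight (A1_dim_const TYPE('a) / (p - 1)) g"
    "AE x in lborel. \<bar>f x\<bar> \<le> 4 * g x" "(\<integral>\<^sup>+x. ennreal (g x powr p) \<partial>lborel) \<le> 1"
proof -
  obtain h :: "'a \<Rightarrow> real" where h [measurable]: "h \<in> borel_measurable borel"
    and h0: "\<And>x. 0 < h x" and h1: "\<And>x. h x \<le> 1" and h_int: "(\<integral>\<^sup>+x. ennreal (h x) \<partial>lborel) \<le> 1"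
    using positive_integrable_function by blast
  define f0 where "f0 = (\<lambda>x. ennreal ((\<bar>f x\<bar> + h x) / 2))"
  have [measurable]: "f0 \<in> borel_measurable borel" unfolding f0_def by measurable
  have f0_int: "(\<integral>\<^sup>+x. enn_powr (f0 x) p \<partial>lborel) \<le> 1"
  proof -
    have "(\<integral>\<^sup>+x. enn_powr (f0 x) p \<partial>lborel) \<le> (\<integral>\<^sup>+x. (ennreal (\<bar>f x\<bar> powr p) + ennreal (h x)) / 2 \<partial>lborel)"
    proof (rule nn_integral_mono)
      fix x
      have "h x powr p \<le> h x powr 1"
        using h0[of x] h1[of x] p by (intro powr_mono') auto
      then have "h x powr p \<le> h x" using h0[of x] by simp
      moreover have "((\<bar>f x\<bar> + h x) / 2) powr p \<le> (\<bar>f x\<bar> powr p + h x powr p) / 2"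
        using p h0[of x] by (intro powr_mean_le) auto
      ultimately have "((\<bar>f x\<bar> + h x) / 2) powr p \<le> (\<bar>f x\<bar> powr p + h x) / 2"
        by simp
      then have "enn_powr (f0 x) p \<le> ennreal ((\<bar>f x\<bar> powr p + h x) / 2)"
        using h0[of x] by (simp add: f0_def enn_powr_ennreal)
      also have "\<dots> = (ennreal (\<bar>f x\<bar> powr p) + ennreal (h x)) / 2"
        using h0[of x] divide_ennreal[of "\<bar>f x\<bar> powr p + h x" 2] by simp
      finally show "enn_powr (f0 x) p \<le> (ennreal (\<bar>f x\<bar> powr p) + ennreal (h x)) / 2" .
    qed
    also have "\<dots> = ((\<integral>\<^sup>+x. ennreal (\<bar>f x\<bar> powr p) \<partial>lborel) + (\<integral>\<^sup>+x. ennreal (h x) \<partial>lborel)) / 2"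
      by (simp add: nn_integral_divide nn_integral_add)
    also have "\<dots> \<le> (1 + 1) / 2"
      using int h_int by (rule ennreal_mean_mono)
    finally show ?thesis by simp
  qed
  obtain g where g [measurable]: "g \<in> borel_measurable borel" and f0_le: "\<And>x. f0 x \<le> 2 * g x"
    and M: "\<And>x. maximal_fun g x \<le> ennreal (16 * 5 ^ DIM('a) / (p - 1)) * g x"
    and "(\<integral>\<^sup>+x. enn_powr (g x) p \<partial>lborel) \<le> (\<integral>\<^sup>+x. enn_powr (f0 x) p \<partial>lborel)"
    using A1_majorant_ennreal[of f0 p] p by auto
  with f0_int have g_int: "(\<integral>\<^sup>+x. enn_powr (g x) p \<partial>lborel) \<le> 1" by simp
  \<comment> \<open>The majorant is infinite only on a null set, because its p-th power is
    integrable. The value 1 put there keeps \<open>v\<close> positive and changes no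
    average.\<close>
  define v where "v = (\<lambda>x. if g x = top then 1 else enn2real (g x))"
  have v [measurable]: "v \<in> borel_measurable borel" unfolding v_def by measurable
  have "AE x in lborel. enn_powr (g x) p \<noteq> \<infinity>"
    using g_int by (intro nn_integral_PInf_AE) (auto simp: top_unique)
  then have vg: "AE x in lborel. ennreal (v x) = g x"
    by eventually_elim (auto simp: v_def enn_powr_def less_top split: if_splits)
  have g_pos: "0 < g x" for x
  proof -
    have "0 < f0 x" using h0[of x] by (simp add: f0_def add_nonneg_pos)
    also have "f0 x \<le> 2 * g x" by (rule f0_le)
    finally have "0 < 2 * g x" .
    then show ?thesis by (simp add: ennreal_zero_less_mult_iff)
  qed
  show ?thesis
  proof
    let ?V = "unit_ball_vol (real DIM('a)) * (2 * real DIM('a)) ^ DIM('a)"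
    have "AE x in lborel. \<forall>Q. is_cube Q \<and> x \<in> Q \<longrightarrow>
      cube_avg (\<lambda>y. ennreal (v y)) Q \<le> ennreal (A1_dim_const TYPE('a) / (p - 1) * v x)"
      using vg
    proof eventually_elim
      case (elim x)
      show ?case
      proof safe
        fix Q assume Q: "is_cube Q" "x \<in> Q"
        have "cube_avg (\<lambda>y. ennreal (v y)) Q = cube_avg g Q"
          unfolding cube_avg_def using vg
          by (intro arg_cong2[where f="(/)"] nn_integral_cong_AE) auto
        also have "\<dots> \<le> ennreal ?V * maximal_fun g x"
          using Q by (rule cube_avg_le_maximal_fun)
        also have "\<dots> \<le> ennreal ?V * (ennreal (16 * 5 ^ DIM('a) / (p - 1)) * ennreal (v x))"
          using M[of x] elim by (intro mult_left_mono) auto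
        also have "\<dots> = ennreal (A1_dim_const TYPE('a) / (p - 1) * v x)"
          using p by (simp add: A1_dim_const_def v_def mult.assoc flip: ennreal_mult)
        finally show "cube_avg (\<lambda>y. ennreal (v y)) Q \<le> ennreal (A1_dim_const TYPE('a) / (p - 1) * v x)" .
      qed
    qed
    moreover have "0 < v x" for x
      using g_pos[of x] by (auto simp: v_def enn2real_positive_iff less_top)
    ultimately show "A1_weight (A1_dim_const TYPE('a) / (p - 1)) v"
      using p A1_dim_const_pos[where 'a='a] by (auto simp: A1_weight_def)
    show "AE x in lborel. \<bar>f x\<bar> \<le> 4 * v x"
      using vg
    proof eventually_elim
      case (elim x)
      have "ennreal ((\<bar>f x\<bar> + h x) / 2) \<le> 2 * ennreal (v x)"
        using f0_le[of x] elim by (simp add: f0_def)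
      also have "\<dots> = ennreal (2 * v x)" by (simp add: ennreal_mult')
      finally have "(\<bar>f x\<bar> + h x) / 2 \<le> 2 * v x"
        by (subst (asm) ennreal_le_iff) (auto simp: v_def)
      then show ?case using h0[of x] by simp
    qed
    have "(\<integral>\<^sup>+x. ennreal (v x powr p) \<partial>lborel) = (\<integral>\<^sup>+x. enn_powr (g x) p \<partial>lborel)"
      using vg by (intro nn_integral_cong_AE, eventually_elim)
        (metis enn_powr_ennreal enn2real_nonneg v_def zero_le_one)
    with g_int show "(\<integral>\<^sup>+x. ennreal (v x powr p) \<partial>lborel) \<le> 1" by simp
  qed
qed

section \<open>\<open>A\<^sub>p\<close> weights built from \<open>A\<^sub>1\<close> weights\<close>

lemma cube_avg_le_of_AE:
  assumes Q: "is_cube Q" and "AE x in lborel. x \<in> Q \<longrightarrow> u x \<le> c"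
  shows "cube_avg u Q \<le> c"
proof (rule cube_avg_leI[OF Q])
  have "(\<integral>\<^sup>+x\<in>Q. u x \<partial>lborel) \<le> (\<integral>\<^sup>+x\<in>Q. c \<partial>lborel)"
    using assms(2) by (intro nn_integral_mono_AE, eventually_elim) (auto simp: indicator_def)
  also have "\<dots> = c * emeasure lborel Q"
    using is_cube_measurable[OF Q] by (simp add: nn_integral_cmult)
  finally show "(\<integral>\<^sup>+x\<in>Q. u x \<partial>lborel) \<le> c * emeasure lborel Q" .
qed

lemma cube_avg_mult:
  assumes Q: "is_cube Q"
  shows "cube_avg u Q * emeasure lborel Q = (\<integral>\<^sup>+x\<in>Q. u x \<partial>lborel)"
  using emeasure_is_cube[OF Q] unfolding cube_avg_def
  by (simp add: ennreal_divide_times ennreal_times_divide[symmetric])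

lemma is_weightI:
  fixes w :: "'a::euclidean_space \<Rightarrow> real"
  assumes w [measurable]: "w \<in> borel_measurable borel" and nonneg: "\<And>x. 0 \<le> w x"
    and fin: "\<And>Q. is_cube Q \<Longrightarrow> cube_avg (\<lambda>x. ennreal (w x)) Q < top"
  shows "is_weight w"
  unfolding is_weight_def
proof (intro conjI allI impI)
  fix K :: "'a set" assume K: "compact K"
  then obtain R where R: "0 < R" "\<And>x. x \<in> K \<Longrightarrow> norm x \<le> R"
    using compact_imp_bounded[OF K] unfolding bounded_pos by auto
  define Q :: "'a set" where "Q = cbox (- (R *\<^sub>R One)) (- (R *\<^sub>R One) + (2 * R) *\<^sub>R One)"
  have Q: "is_cube Q" unfolding is_cube_def Q_def using R(1)
    by (intro exI[of _ "- (R *\<^sub>R One)"] exI[of _ "2 * R"]) simp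
  have "x \<in> Q" if "x \<in> K" for x
  proof -
    have "\<bar>x \<bullet> b\<bar> \<le> R" if "b \<in> Basis" for b
      using Basis_le_norm[OF that, of x] R(2)[OF \<open>x \<in> K\<close>] by simp
    then have "- R \<le> x \<bullet> b \<and> x \<bullet> b \<le> R" if "b \<in> Basis" for b
      using that by (simp add: abs_le_iff minus_le_iff)
    then show ?thesis by (simp add: Q_def mem_box inner_add_left inner_diff_left)
  qed
  then have KQ: "K \<subseteq> Q" by auto
  have Km [measurable]: "K \<in> sets borel" using K by (simp add: compact_imp_closed)
  have "(\<integral>\<^sup>+x. ennreal (norm (indicator K x *\<^sub>R w x)) \<partial>lborel) \<le> (\<integral>\<^sup>+x\<in>Q. ennreal (w x) \<partial>lborel)"
    using KQ nonneg by (intro nn_integral_mono) (auto simp: indicator_def)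
  also have "\<dots> = cube_avg (\<lambda>x. ennreal (w x)) Q * emeasure lborel Q"
    using Q by (simp add: cube_avg_mult)
  also have "\<dots> < top"
    using fin[OF Q] emeasure_is_cube[OF Q] by (simp add: ennreal_mult_less_top)
  finally show "set_integrable lborel K w"
    unfolding set_integrable_def by (intro integrableI_bounded) auto
qed (use nonneg in auto)

lemma in_ApI:
  fixes w :: "'a::euclidean_space \<Rightarrow> real"
  assumes w: "w \<in> borel_measurable borel" and nonneg: "\<And>x. 0 \<le> w x" and p: "1 < p"
    and avg: "\<And>Q. is_cube Q \<Longrightarrow> \<exists>a b. 0 \<le> a \<and> 0 \<le> b \<and>
      cube_avg (\<lambda>x. ennreal (w x)) Q \<le> ennreal a \<and>
      cube_avg (\<lambda>x. inverse (ennreal (w x powr (1 / (p - 1))))) Q \<le> ennreal b \<and>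
      a * b powr (p - 1) \<le> B"
  shows "in_Ap p w" "Ap_const p w \<le> ennreal B"
proof -
  show le: "Ap_const p w \<le> ennreal B"
    unfolding Ap_const_def
  proof (rule SUP_least)
    fix Q :: "'a set" assume "Q \<in> Collect is_cube"
    then obtain a b where ab: "0 \<le> a" "0 \<le> b" "cube_avg (\<lambda>x. ennreal (w x)) Q \<le> ennreal a"
      "cube_avg (\<lambda>x. inverse (ennreal (w x powr (1 / (p - 1))))) Q \<le> ennreal b" "a * b powr (p - 1) \<le> B"
      using avg by blast
    let ?a1 = "cube_avg (\<lambda>x. ennreal (w x)) Q"
    let ?a2 = "cube_avg (\<lambda>x. inverse (ennreal (w x powr (1 / (p - 1))))) Q"
    \<comment> \<open>This excludes the branch of \<open>Ap_const\<close> that assigns the value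
      \<open>top\<close>.\<close>
    have "?a2 \<noteq> top" using ab(4) by (auto simp: top_unique)
    moreover have "?a1 * enn_powr ?a2 (p - 1) \<le> ennreal a * enn_powr (ennreal b) (p - 1)"
      using ab p by (intro mult_mono enn_powr_mono) auto
    moreover have "\<dots> = ennreal (a * b powr (p - 1))"
      using ab by (simp add: enn_powr_ennreal ennreal_mult')
    moreover have "\<dots> \<le> ennreal B" using ab by (intro ennreal_leI)
    ultimately show "(let a1 = ?a1; a2 = ?a2 in if a2 = top then top else a1 * enn_powr a2 (p - 1)) \<le> ennreal B"
      by (simp add: Let_def)
  qed
  have "is_weight w"
    using w nonneg
  proof (rule is_weightI)
    fix Q :: "'a set" assume "is_cube Q"
    from avg[OF this] show "cube_avg (\<lambda>x. ennreal (w x)) Q < top"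
      using le_less_trans ennreal_less_top by blast
  qed
  with le show "in_Ap p w"
    unfolding in_Ap_def using le_less_trans ennreal_less_top by blast
qed

text \<open>A cube has positive measure, so an infinite average would contradict the finiteness of
  \<open>K * g\<close>, and a zero average the positivity of \<open>g\<close>. The lower bound
  \<open>m / K\<close> on the cube is the form in which the \<open>A1_weight\<close> condition
  enters both estimates of \<open>Ap_const\<close> below.\<close>

lemma A1_weight_avg:
  fixes g :: "'a::euclidean_space \<Rightarrow> real"
  assumes g: "A1_weight K g" and Q: "is_cube Q"
  obtains m where "0 < m" "cube_avg (\<lambda>x. ennreal (g x)) Q = ennreal m"
    "AE x in lborel. x \<in> Q \<longrightarrow> m / K \<le> g x"
proof -
  let ?A = "cube_avg (\<lambda>x. ennreal (g x)) Q"
  have K: "0 < K" and [measurable]: "g \<in> borel_measurable borel" and pos: "\<And>x. 0 < g x"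
    and ae: "AE x in lborel. x \<in> Q \<longrightarrow> ?A \<le> ennreal (K * g x)"
    using g Q by (auto simp: A1_weight_def)
  have [measurable]: "Q \<in> sets borel" using Q by (rule is_cube_measurable)
  have "?A \<noteq> top"
  proof
    assume "?A = top"
    with ae have "AE x in lborel. x \<notin> Q" by (simp add: top_unique)
    then have "emeasure lborel Q = 0" by (subst (asm) AE_iff_measurable[of Q]) auto
    then show False using emeasure_is_cube[OF Q] by simp
  qed
  then obtain m where m: "?A = ennreal m" "0 \<le> m" by (cases ?A) auto
  have "?A \<noteq> 0"
  proof
    assume "?A = 0"
    then have "(\<integral>\<^sup>+x\<in>Q. ennreal (g x) \<partial>lborel) = 0"
      using cube_avg_mult[OF Q, of "\<lambda>x. ennreal (g x)"] by simp
    then have "AE x in lborel. ennreal (g x) * indicator Q x = 0"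
      by (subst (asm) nn_integral_0_iff_AE) auto
    then have "AE x in lborel. x \<notin> Q"
    proof eventually_elim
      case (elim x)
      then show ?case using pos[of x] by (cases "x \<in> Q") (auto simp: ennreal_eq_0_iff)
    qed
    then have "emeasure lborel Q = 0" by (subst (asm) AE_iff_measurable[of Q]) auto
    then show False using emeasure_is_cube[OF Q] by simp
  qed
  with m have m0: "0 < m" by (cases "m = 0") auto
  show ?thesis
  proof
    show "AE x in lborel. x \<in> Q \<longrightarrow> m / K \<le> g x"
      using ae
    proof eventually_elim
      case (elim x)
      show ?case
      proof
        assume "x \<in> Q"
        with elim have "ennreal m \<le> ennreal (K * g x)" using m by simp
        then have "m \<le> K * g x" using K pos[of x] by (subst (asm) ennreal_le_iff) auto
        then show "m / K \<le> g x" using K by (simp add: pos_divide_le_eq mult.commute)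
      qed
    qed
  qed (use m m0 in auto)
qed

lemma A1_weight_scale:
  assumes g: "A1_weight K g" and c: "0 < c"
  shows "A1_weight K (\<lambda>x. c * g x)"
proof -
  have [measurable]: "g \<in> borel_measurable borel" and pos: "\<And>x. 0 < g x"
    and ae: "AE x in lborel. \<forall>Q. is_cube Q \<and> x \<in> Q \<longrightarrow> cube_avg (\<lambda>y. ennreal (g y)) Q \<le> ennreal (K * g x)"
    using g by (auto simp: A1_weight_def)
  have avg: "cube_avg (\<lambda>y. ennreal (c * g y)) Q = ennreal c * cube_avg (\<lambda>y. ennreal (g y)) Q" if "is_cube Q" for Q
  proof -
    have [measurable]: "Q \<in> sets borel" using that by (rule is_cube_measurable)
    have "(\<integral>\<^sup>+x\<in>Q. ennreal (c * g x) \<partial>lborel) = ennreal c * (\<integral>\<^sup>+x\<in>Q. ennreal (g x) \<partial>lborel)"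
      using c by (simp add: ennreal_mult' mult.assoc nn_integral_cmult)
    then show ?thesis by (simp add: cube_avg_def ennreal_times_divide)
  qed
  have "AE x in lborel. \<forall>Q. is_cube Q \<and> x \<in> Q \<longrightarrow> cube_avg (\<lambda>y. ennreal (c * g y)) Q \<le> ennreal (K * (c * g x))"
    using ae
  proof eventually_elim
    case (elim x)
    show ?case
    proof safe
      fix Q assume Q: "is_cube Q" "x \<in> Q"
      with elim have "ennreal c * cube_avg (\<lambda>y. ennreal (g y)) Q \<le> ennreal c * ennreal (K * g x)"
        by (intro mult_left_mono) auto
      also have "\<dots> = ennreal (K * (c * g x))"
        using c by (simp add: mult.left_commute ennreal_mult'[symmetric])
      finally show "cube_avg (\<lambda>y. ennreal (c * g y)) Q \<le> ennreal (K * (c * g x))"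
        using Q by (simp add: avg)
    qed
  qed
  then show ?thesis using g c by (simp add: A1_weight_def)
qed

text \<open>On a cube with mean \<open>m\<close> the weight is at least \<open>m / K\<close>, so the
  dual average raised to the power \<open>p - 1\<close> is at most \<open>K / m\<close>, and
  \<open>m\<close> cancels.\<close>

lemma in_Ap_of_A1_weight:
  fixes w :: "'a::euclidean_space \<Rightarrow> real"
  assumes w: "A1_weight K w" and p: "1 < p"
  shows "in_Ap p w" "Ap_const p w \<le> ennreal K"
proof -
  have K: "0 < K" and wm: "w \<in> borel_measurable borel" and pos: "\<And>x. 0 < w x"
    using w by (auto simp: A1_weight_def)
  have "\<exists>a b. 0 \<le> a \<and> 0 \<le> b \<and>
      cube_avg (\<lambda>x. ennreal (w x)) Q \<le> ennreal a \<and>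
      cube_avg (\<lambda>x. inverse (ennreal (w x powr (1 / (p - 1))))) Q \<le> ennreal b \<and>
      a * b powr (p - 1) \<le> K" if Q: "is_cube Q" for Q
  proof -
    from w Q obtain m where m: "0 < m" "cube_avg (\<lambda>x. ennreal (w x)) Q = ennreal m"
      and ae: "AE x in lborel. x \<in> Q \<longrightarrow> m / K \<le> w x"
      by (rule A1_weight_avg)
    let ?b = "(K / m) powr (1 / (p - 1))"
    have "AE x in lborel. x \<in> Q \<longrightarrow> inverse (ennreal (w x powr (1 / (p - 1)))) \<le> ennreal ?b"
      using ae
    proof eventually_elim
      case (elim x)
      show ?case
      proof
        assume "x \<in> Q"
        with elim have "m / K \<le> w x" by simp
        then have "inverse (w x) \<le> inverse (m / K)"
          using m K by (intro le_imp_inverse_le) auto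
        then have "inverse (w x) powr (1 / (p - 1)) \<le> ?b"
          using pos[of x] p by (intro powr_mono2) auto
        then show "inverse (ennreal (w x powr (1 / (p - 1)))) \<le> ennreal ?b"
          using pos[of x] by (simp add: inverse_ennreal inverse_powr ennreal_leI)
      qed
    qed
    then have "cube_avg (\<lambda>x. inverse (ennreal (w x powr (1 / (p - 1))))) Q \<le> ennreal ?b"
      by (rule cube_avg_le_of_AE[OF Q])
    moreover have "m * ?b powr (p - 1) = K"
      using m K p by (simp add: powr_powr)
    ultimately show ?thesis using m by (intro exI[of _ m] exI[of _ ?b]) auto
  qed
  then show "in_Ap p w" "Ap_const p w \<le> ennreal K"
    using in_ApI[OF wm, of p K] pos p less_imp_le by blast+
qed

text \<open>With \<open>m\<close> the mean of \<open>y\<close> over a cube, averaging this gives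
  Jensen's inequality for the concave power \<open>\<theta>\<close> up to a factor 2. Each summand
  alone suffices on one side of \<open>y = m\<close>.\<close>

lemma powr_le_tangent:
  fixes y m \<theta> :: real
  assumes "0 < y" "0 < m" "0 \<le> \<theta>" "\<theta> \<le> 1"
  shows "y powr \<theta> \<le> m powr \<theta> + m powr (\<theta> - 1) * y"
proof (cases "y \<le> m")
  case True
  then have "y powr \<theta> \<le> m powr \<theta>" using assms by (intro powr_mono2) auto
  then show ?thesis using assms by (simp add: add_increasing2)
next
  case False
  then have "y powr (\<theta> - 1) \<le> m powr (\<theta> - 1)" using assms by (intro powr_mono2') auto
  then have "y powr (\<theta> - 1) * y \<le> m powr (\<theta> - 1) * y" using assms by (intro mult_right_mono) auto
  moreover have "y powr (\<theta> - 1) * y = y powr \<theta>"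
    using assms powr_add[of y "\<theta> - 1" 1] by simp
  ultimately show ?thesis by (simp add: add_increasing)
qed

text \<open>The dual weight is \<open>g powr \<theta>\<close> with
  \<open>\<theta> = \<delta> / (p - 1)\<close> in \<open>[0, 1]\<close>, so its average is at most
  \<open>2 * m powr \<theta>\<close>, where \<open>m\<close> is the mean of \<open>g\<close>. The
  weight itself is at most \<open>(m / K) powr - \<delta>\<close> on the cube. The powers of
  \<open>m\<close> cancel in the product.\<close>

lemma in_Ap_powr_of_A1_weight:
  fixes g :: "'a::euclidean_space \<Rightarrow> real"
  assumes g: "A1_weight K g" and p: "1 < p" and \<delta>: "0 \<le> \<delta>" "\<delta> \<le> p - 1"
  shows "in_Ap p (\<lambda>x. g x powr - \<delta>)" "Ap_const p (\<lambda>x. g x powr - \<delta>) \<le> ennreal (2 powr (p - 1) * K powr \<delta>)"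
proof -
  have K: "0 < K" and gm [measurable]: "g \<in> borel_measurable borel" and pos: "\<And>x. 0 < g x"
    using g by (auto simp: A1_weight_def)
  define \<theta> where "\<theta> = \<delta> / (p - 1)"
  have \<theta>: "0 \<le> \<theta>" "\<theta> \<le> 1" "\<theta> * (p - 1) = \<delta>" using p \<delta> by (auto simp: \<theta>_def)
  have dual: "inverse (ennreal ((g x powr - \<delta>) powr (1 / (p - 1)))) = ennreal (g x powr \<theta>)" for x
    using pos[of x] by (simp add: inverse_ennreal powr_powr \<theta>_def flip: powr_minus)
  have "\<exists>a b. 0 \<le> a \<and> 0 \<le> b \<and>
      cube_avg (\<lambda>x. ennreal (g x powr - \<delta>)) Q \<le> ennreal a \<and>
      cube_avg (\<lambda>x. inverse (ennreal ((g x powr - \<delta>) powr (1 / (p - 1))))) Q \<le> ennreal b \<and>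
      a * b powr (p - 1) \<le> 2 powr (p - 1) * K powr \<delta>" if Q: "is_cube Q" for Q
  proof -
    from g Q obtain m where m: "0 < m" "cube_avg (\<lambda>x. ennreal (g x)) Q = ennreal m"
      and ae: "AE x in lborel. x \<in> Q \<longrightarrow> m / K \<le> g x"
      by (rule A1_weight_avg)
    have [measurable]: "Q \<in> sets borel" using Q by (rule is_cube_measurable)
    let ?a = "(m / K) powr - \<delta>" and ?b = "2 * m powr \<theta>"
    have "AE x in lborel. x \<in> Q \<longrightarrow> ennreal (g x powr - \<delta>) \<le> ennreal ?a"
      using ae by eventually_elim (use \<delta> m K in \<open>auto intro!: ennreal_leI powr_mono2'\<close>)
    then have a: "cube_avg (\<lambda>x. ennreal (g x powr - \<delta>)) Q \<le> ennreal ?a"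
      by (rule cube_avg_le_of_AE[OF Q])
    have b: "cube_avg (\<lambda>x. ennreal (g x powr \<theta>)) Q \<le> ennreal ?b"
    proof (rule cube_avg_leI[OF Q])
      let ?c = "ennreal (m powr \<theta>)" and ?e = "ennreal (m powr (\<theta> - 1))"
      have "(\<integral>\<^sup>+x\<in>Q. ennreal (g x powr \<theta>) \<partial>lborel) \<le>
        (\<integral>\<^sup>+x. ?c * indicator Q x + ?e * (ennreal (g x) * indicator Q x) \<partial>lborel)"
      proof (intro nn_integral_mono)
        fix x
        have "ennreal (g x powr \<theta>) \<le> ennreal (m powr \<theta> + m powr (\<theta> - 1) * g x)"
          using pos[of x] m \<theta> by (intro ennreal_leI powr_le_tangent) auto
        also have "\<dots> = ?c + ?e * ennreal (g x)"
          using pos[of x] by (simp add: ennreal_mult')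
        finally show "ennreal (g x powr \<theta>) * indicator Q x \<le> ?c * indicator Q x + ?e * (ennreal (g x) * indicator Q x)"
          by (auto simp: indicator_def)
      qed
      also have "\<dots> = ?c * emeasure lborel Q + ?e * (\<integral>\<^sup>+x\<in>Q. ennreal (g x) \<partial>lborel)"
        by (simp add: nn_integral_add nn_integral_cmult)
      also have "(\<integral>\<^sup>+x\<in>Q. ennreal (g x) \<partial>lborel) = ennreal m * emeasure lborel Q"
        using cube_avg_mult[OF Q, of "\<lambda>x. ennreal (g x)"] m by simp
      also have "?e * (ennreal m * emeasure lborel Q) = ?c * emeasure lborel Q"
        using m powr_add[of m "\<theta> - 1" 1] by (simp add: mult.assoc[symmetric] ennreal_mult'[symmetric])
      also have "?c * emeasure lborel Q + ?c * emeasure lborel Q = ennreal ?b * emeasure lborel Q"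
        by (simp add: distrib_right[symmetric] flip: ennreal_plus)
      finally show "(\<integral>\<^sup>+x\<in>Q. ennreal (g x powr \<theta>) \<partial>lborel) \<le> ennreal ?b * emeasure lborel Q" .
    qed
    have "?b powr (p - 1) = 2 powr (p - 1) * m powr \<delta>"
      using m \<theta> by (simp add: powr_mult powr_powr)
    then have "?a * ?b powr (p - 1) = 2 powr (p - 1) * K powr \<delta>"
      using m K by (simp add: powr_minus powr_divide)
    then show ?thesis
      using a b m by (intro exI[of _ ?a] exI[of _ ?b]) (simp add: dual)
  qed
  then show "in_Ap p (\<lambda>x. g x powr - \<delta>)" "Ap_const p (\<lambda>x. g x powr - \<delta>) \<le> ennreal (2 powr (p - 1) * K powr \<delta>)"
    using in_ApI[of "\<lambda>x. g x powr - \<delta>" p "2 powr (p - 1) * K powr \<delta>"] p by simp_all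
qed

section \<open>Extrapolation to unweighted weak-type bounds\<close>

text \<open>The level sets of \<open>T f\<close> need not be measurable; \<^const>\<open>wmeasure\<close> is then an inner measure.\<close>

lemma wmeasure_one_le:
  fixes E :: "'a::euclidean_space set"
  assumes "\<And>F. F \<in> sets borel \<Longrightarrow> F \<subseteq> E \<Longrightarrow> emeasure lborel F < top \<Longrightarrow> emeasure lborel F \<le> B"
  shows "wmeasure (\<lambda>_. 1) E \<le> B"
  unfolding wmeasure_def nn_integral_def
proof (rule SUP_least)
  fix u :: "'a \<Rightarrow> ennreal"
  assume "u \<in> {g. simple_function lborel g \<and> g \<le> (\<lambda>x. ennreal 1 * indicator E x)}"
  then have sf: "simple_function lborel u" and le: "\<And>x. u x \<le> indicator E x"
    by (auto simp: le_fun_def)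
  then have [measurable]: "u \<in> borel_measurable borel"
    using borel_measurable_simple_function by force
  \<comment> \<open>The support of a simple function below the indicator of \<open>E\<close> is a
    Borel subset of \<open>E\<close>, and its measure dominates the integral of
    \<open>u\<close>.\<close>
  define F where "F = {x. u x \<noteq> 0}"
  have F [measurable]: "F \<in> sets borel" unfolding F_def by measurable
  have "F \<subseteq> E"
  proof
    fix x assume "x \<in> F"
    then show "x \<in> E" using le[of x] by (cases "x \<in> E") (auto simp: F_def)
  qed
  have "integral\<^sup>S lborel u = (\<integral>\<^sup>+x. u x \<partial>lborel)"
    using sf by (simp add: nn_integral_eq_simple_integral)
  also have "\<dots> \<le> (\<integral>\<^sup>+x. indicator F x \<partial>lborel)"
  proof (intro nn_integral_mono)
    fix x
    have "indicator E x \<le> (1::ennreal)" by (simp add: indicator_def)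
    with le[of x] have "u x \<le> 1" by (rule order_trans)
    then show "u x \<le> indicator F x" by (auto simp: F_def indicator_def)
  qed
  also have "\<dots> = emeasure lborel F" by simp
  \<comment> \<open>Exhaustion by balls reduces to sets of finite measure, whose indicators can be
    normalised when \<open>p\<close> is large.\<close>
  also have "F = (\<Union>n. F \<inter> cball 0 (real n))"
    using real_arch_simple by (auto simp: dist_norm)
  then have "emeasure lborel F = (SUP n. emeasure lborel (F \<inter> cball 0 (real n)))"
    by (subst SUP_emeasure_incseq) (auto simp: incseq_def)
  also have "\<dots> \<le> B"
  proof (rule SUP_least)
    fix n
    have "emeasure lborel (F \<inter> cball 0 (real n)) \<le> emeasure lborel (cball 0 (real n) :: 'a set)"
      by (intro emeasure_mono) auto
    also have "\<dots> < top" by (simp add: emeasure_cball)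
    finally show "emeasure lborel (F \<inter> cball 0 (real n)) \<le> B"
      using \<open>F \<subseteq> E\<close> by (intro assms) auto
  qed
  finally show "integral\<^sup>S lborel u \<le> B" .
qed

lemma Lp_norm_le_one_iff:
  assumes "0 < p"
  shows "Lp_norm p w f \<le> 1 \<longleftrightarrow> (\<integral>\<^sup>+x. ennreal (\<bar>f x\<bar> powr p * w x) \<partial>lborel) \<le> 1"
  unfolding Lp_norm_def using assms enn_powr_ennreal[of 1 p] by (simp add: enn_powr_root_le_iff)

text \<open>The operator bound is tested on Borel subsets \<open>F\<close> of finite measure inside
  the level sets, which makes \<open>F\<close> available as a set to integrate over and to build
  weights from.\<close>

lemma unw_op_norm_le:
  fixes T :: "('a::euclidean_space \<Rightarrow> real) \<Rightarrow> ('a \<Rightarrow> real)"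
  assumes p: "0 < p" and B: "0 \<le> B"
    and level: "\<And>f t F. f \<in> borel_measurable borel \<Longrightarrow>
      (\<integral>\<^sup>+x. ennreal (\<bar>f x\<bar> powr p) \<partial>lborel) \<le> 1 \<Longrightarrow> 0 < t \<Longrightarrow> F \<in> sets borel \<Longrightarrow>
      F \<subseteq> {x. t < \<bar>T f x\<bar>} \<Longrightarrow> emeasure lborel F < top \<Longrightarrow> emeasure lborel F \<le> ennreal ((B / t) powr p)"
  shows "unw_op_norm T p \<le> ennreal B"
  unfolding unw_op_norm_def weak_op_norm_def weak_Lp_norm_def
proof (intro SUP_least)
  fix f :: "'a \<Rightarrow> real" and t :: real
  assume "f \<in> {f. f \<in> borel_measurable lborel \<and> Lp_norm p (\<lambda>_. 1) f \<le> 1}" and "t \<in> {0<..}"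
  then have f: "f \<in> borel_measurable borel" "(\<integral>\<^sup>+x. ennreal (\<bar>f x\<bar> powr p) \<partial>lborel) \<le> 1" and t: "0 < t"
    using p by (auto simp: Lp_norm_le_one_iff)
  have "wmeasure (\<lambda>_. 1) {x. t < \<bar>T f x\<bar>} \<le> ennreal ((B / t) powr p)"
    using f t by (intro wmeasure_one_le level)
  then have "enn_powr (wmeasure (\<lambda>_. 1) {x. t < \<bar>T f x\<bar>}) (1 / p) \<le> ennreal (B / t)"
    using p B t by (simp add: enn_powr_root_le_iff enn_powr_ennreal)
  then have "ennreal t * enn_powr (wmeasure (\<lambda>_. 1) {x. t < \<bar>T f x\<bar>}) (1 / p) \<le> ennreal t * ennreal (B / t)"
    by (rule mult_left_mono) simp
  also have "\<dots> = ennreal B" using t B by (simp flip: ennreal_mult)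
  finally show "ennreal t * enn_powr (wmeasure (\<lambda>_. 1) {x. t < \<bar>T f x\<bar>}) (1 / p) \<le> ennreal B" .
qed

definition weak_Ap_bound ::
  "(('a::euclidean_space \<Rightarrow> real) \<Rightarrow> ('a \<Rightarrow> real)) \<Rightarrow> real \<Rightarrow> real \<Rightarrow> real \<Rightarrow> bool" where
  "weak_Ap_bound T p c \<beta> \<longleftrightarrow>
     (\<forall>w. in_Ap p w \<longrightarrow> weak_op_norm T p w \<le> ennreal c * enn_powr (Ap_const p w) \<beta>)"

lemma weak_Ap_bound_level_set:
  fixes T :: "('a::euclidean_space \<Rightarrow> real) \<Rightarrow> ('a \<Rightarrow> real)"
  assumes T: "weak_Ap_bound T p c \<beta>" and pc: "0 < p" "0 < c" "0 < \<beta>"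
    and w: "in_Ap p w" "Ap_const p w \<le> ennreal A" "0 \<le> A"
    and f: "f \<in> borel_measurable borel" "(\<integral>\<^sup>+x. ennreal (\<bar>f x\<bar> powr p * w x) \<partial>lborel) \<le> 1"
    and t: "0 < t" and F: "F \<subseteq> {x. t < \<bar>T f x\<bar>}"
  shows "(\<integral>\<^sup>+x\<in>F. ennreal (w x) \<partial>lborel) \<le> ennreal ((c * A powr \<beta> / t) powr p)"
proof -
  let ?E = "{x. t < \<bar>T f x\<bar>}" and ?D = "c * A powr \<beta>"
  have "ennreal t * enn_powr (wmeasure w ?E) (1 / p) \<le> weak_Lp_norm p w (T f)"
    unfolding weak_Lp_norm_def using t by (intro SUP_upper2[of t]) auto
  also have "\<dots> \<le> weak_op_norm T p w"
    unfolding weak_op_norm_def using f pc by (intro SUP_upper) (auto simp: Lp_norm_le_one_iff)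
  also have "\<dots> \<le> ennreal c * enn_powr (Ap_const p w) \<beta>"
    using T w by (auto simp: weak_Ap_bound_def)
  also have "\<dots> \<le> ennreal c * enn_powr (ennreal A) \<beta>"
    using w pc by (intro mult_left_mono enn_powr_mono) auto
  also have "\<dots> = ennreal ?D"
    using w pc by (simp add: enn_powr_ennreal ennreal_mult')
  finally have "ennreal (1 / t) * (ennreal t * enn_powr (wmeasure w ?E) (1 / p)) \<le> ennreal (1 / t) * ennreal ?D"
    by (rule mult_left_mono) simp
  moreover have "ennreal (1 / t) * ennreal t = 1" using t by (simp flip: ennreal_mult)
  moreover have "ennreal (1 / t) * ennreal ?D = ennreal (?D / t)"
    using t pc by (simp flip: ennreal_mult)
  ultimately have "enn_powr (wmeasure w ?E) (1 / p) \<le> ennreal (?D / t)"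
    by (simp add: mult.assoc[symmetric])
  then have "wmeasure w ?E \<le> ennreal ((?D / t) powr p)"
    using pc t by (simp add: enn_powr_root_le_iff enn_powr_ennreal)
  moreover have "(\<integral>\<^sup>+x\<in>F. ennreal (w x) \<partial>lborel) \<le> wmeasure w ?E"
    unfolding wmeasure_def using F by (intro nn_integral_mono mult_left_mono) (auto simp: indicator_def)
  ultimately show ?thesis by simp
qed

text \<open>Since \<open>\<bar>f\<bar> <= G\<close> almost everywhere, multiplying
  \<open>\<bar>f\<bar> powr p0\<close> by \<open>G powr - (p0 - p)\<close> leaves at most
  \<open>\<bar>f\<bar> powr p\<close>. The hypothesis then controls the weighted measure of a level
  set; Lebesgue measure is recovered where \<open>G\<close> is small because the weight is large
  there, and where \<open>G\<close> is large by Chebyshev's inequality.\<close>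

lemma unw_op_norm_le_near_one:
  fixes T :: "('a::euclidean_space \<Rightarrow> real) \<Rightarrow> ('a \<Rightarrow> real)"
  assumes T: "weak_Ap_bound T p0 c \<beta>" and pc: "1 < p0" "0 < c" "0 < \<beta>"
    and p: "1 < p" "p < p0" "p \<le> 2"
  shows "unw_op_norm T p \<le>
    ennreal (17 * c * (2 * max 1 (A1_dim_const TYPE('a)) / (p - 1)) powr ((p0 - 1) * \<beta>))"
proof -
  define C where "C = A1_dim_const TYPE('a)"
  define \<delta> where "\<delta> = p0 - p"
  \<comment> \<open>The maximum with 1, together with \<open>p <= 2\<close>, makes
    \<open>max 1 C / (p - 1)\<close> at least 1, so the exponent \<open>\<delta>\<close> may be
    raised to \<open>p0 - 1\<close>.\<close>
  define A where "A = (2 * max 1 C / (p - 1)) powr (p0 - 1)"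
  define D where "D = c * A powr \<beta>"
  have C: "0 < C" unfolding C_def by (rule A1_dim_const_pos)
  have \<delta>: "0 \<le> \<delta>" "\<delta> \<le> p0 - 1" using p by (auto simp: \<delta>_def)
  have A0: "0 < A" using p by (simp add: A_def max_def)
  have D0: "0 < D" using pc A0 by (simp add: D_def)
  have "unw_op_norm T p \<le> ennreal (17 * D)"
  proof (rule unw_op_norm_le)
    fix f :: "'a \<Rightarrow> real" and t :: real and F
    assume f [measurable]: "f \<in> borel_measurable borel"
      and f_int: "(\<integral>\<^sup>+x. ennreal (\<bar>f x\<bar> powr p) \<partial>lborel) \<le> 1" and t: "0 < t"
      and F [measurable]: "F \<in> sets borel" and FE: "F \<subseteq> {x. t < \<bar>T f x\<bar>}"
    obtain g where g: "A1_weight (C / (p - 1)) g" and fg: "AE x in lborel. \<bar>f x\<bar> \<le> 4 * g x"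
      and g_int: "(\<integral>\<^sup>+x. ennreal (g x powr p) \<partial>lborel) \<le> 1"
      unfolding C_def using A1_majorant[OF f p(1,3) f_int] by blast
    define G where "G = (\<lambda>x. 4 * g x)"
    have G: "A1_weight (C / (p - 1)) G"
      unfolding G_def using g by (rule A1_weight_scale) simp
    have [measurable]: "G \<in> borel_measurable borel" "g \<in> borel_measurable borel"
      and pos: "\<And>x. 0 < G x" and gpos: "\<And>x. 0 < g x"
      using G g by (auto simp: A1_weight_def)
    have G_int: "(\<integral>\<^sup>+x. ennreal (G x powr p) \<partial>lborel) \<le> 16"
    proof -
      have "(\<integral>\<^sup>+x. ennreal (G x powr p) \<partial>lborel) = (\<integral>\<^sup>+x. ennreal (4 powr p) * ennreal (g x powr p) \<partial>lborel)"
        using gpos by (intro nn_integral_cong) (simp add: G_def powr_mult less_imp_le flip: ennreal_mult)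
      also have "\<dots> = ennreal (4 powr p) * (\<integral>\<^sup>+x. ennreal (g x powr p) \<partial>lborel)"
        by (simp add: nn_integral_cmult)
      also have "\<dots> \<le> ennreal (4 powr 2) * 1"
        using g_int p by (intro mult_mono ennreal_leI powr_mono) auto
      finally show ?thesis by simp
    qed
    let ?w = "\<lambda>x. G x powr - \<delta>"
    have Ap: "in_Ap p0 ?w" "Ap_const p0 ?w \<le> ennreal A"
    proof -
      show "in_Ap p0 ?w" using G pc(1) \<delta> by (rule in_Ap_powr_of_A1_weight)
      have "Ap_const p0 ?w \<le> ennreal (2 powr (p0 - 1) * (C / (p - 1)) powr \<delta>)"
        using G pc(1) \<delta> by (rule in_Ap_powr_of_A1_weight)
      also have "\<dots> \<le> ennreal A"
      proof (rule ennreal_leI)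
        have "(C / (p - 1)) powr \<delta> \<le> (max 1 C / (p - 1)) powr \<delta>"
          using C p \<delta> by (intro powr_mono2 divide_right_mono) auto
        also have "\<dots> \<le> (max 1 C / (p - 1)) powr (p0 - 1)"
          using p \<delta> by (intro powr_mono) (auto simp: le_divide_eq)
        finally have "2 powr (p0 - 1) * (C / (p - 1)) powr \<delta> \<le> 2 powr (p0 - 1) * (max 1 C / (p - 1)) powr (p0 - 1)"
          by (intro mult_left_mono) auto
        also have "\<dots> = (2 * (max 1 C / (p - 1))) powr (p0 - 1)"
          using p C by (intro powr_mult[symmetric])
        also have "\<dots> = A" by (simp add: A_def)
        finally show "2 powr (p0 - 1) * (C / (p - 1)) powr \<delta> \<le> A" .
      qed
      finally show "Ap_const p0 ?w \<le> ennreal A" .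
    qed
    have "(\<integral>\<^sup>+x. ennreal (\<bar>f x\<bar> powr p0 * ?w x) \<partial>lborel) \<le> (\<integral>\<^sup>+x. ennreal (\<bar>f x\<bar> powr p) \<partial>lborel)"
    proof (rule nn_integral_mono_AE)
      show "AE x in lborel. ennreal (\<bar>f x\<bar> powr p0 * ?w x) \<le> ennreal (\<bar>f x\<bar> powr p)"
        using fg
      proof eventually_elim
        case (elim x)
        have "\<bar>f x\<bar> powr \<delta> \<le> G x powr \<delta>"
          using elim \<delta> by (intro powr_mono2) (auto simp: G_def)
        then have "\<bar>f x\<bar> powr \<delta> * ?w x \<le> G x powr \<delta> * ?w x"
          by (rule mult_right_mono) simp
        also have "\<dots> = 1" using pos[of x] by (simp flip: powr_add)
        finally have "\<bar>f x\<bar> powr p * (\<bar>f x\<bar> powr \<delta> * ?w x) \<le> \<bar>f x\<bar> powr p * 1"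
          by (rule mult_left_mono) simp
        moreover have "\<bar>f x\<bar> powr p0 = \<bar>f x\<bar> powr p * \<bar>f x\<bar> powr \<delta>"
          by (simp add: \<delta>_def flip: powr_add)
        ultimately show ?case by (intro ennreal_leI) (simp add: mult.assoc)
      qed
    qed
    also note f_int
    finally have level: "(\<integral>\<^sup>+x\<in>F. ennreal (?w x) \<partial>lborel) \<le> ennreal ((D / t) powr p0)"
      unfolding D_def using T pc Ap A0 f t FE by (intro weak_Ap_bound_level_set[where T=T]) auto
    \<comment> \<open>This level balances the two parts: both \<open>s powr - p\<close> and
      \<open>s powr \<delta> * (D / t) powr p0\<close> equal \<open>(D / t) powr p\<close>. With the
      bound 16 for the integral of \<open>G powr p\<close>, the total constant is 17.\<close>
    define s where "s = t / D"
    have s: "0 < s" using t D0 by (simp add: s_def)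
    have "emeasure lborel F = (\<integral>\<^sup>+x. indicator F x \<partial>lborel)" by simp
    \<comment> \<open>splitting \<open>F\<close> at the level \<open>G = s\<close> takes the place of Hoelder's inequality\<close>
    also have "\<dots> \<le> (\<integral>\<^sup>+x. ennreal (s powr - p) * ennreal (G x powr p) +
      ennreal (s powr \<delta>) * (ennreal (?w x) * indicator F x) \<partial>lborel)"
    proof (intro nn_integral_mono)
      fix x
      show "indicator F x \<le> ennreal (s powr - p) * ennreal (G x powr p) +
        ennreal (s powr \<delta>) * (ennreal (?w x) * indicator F x)"
      proof (cases "G x \<le> s")
        case True
        have "s powr - \<delta> \<le> ?w x"
          using True pos[of x] \<delta> by (intro powr_mono2') auto
        then have "s powr \<delta> * s powr - \<delta> \<le> s powr \<delta> * ?w x"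
          by (rule mult_left_mono) simp
        then have "1 \<le> s powr \<delta> * ?w x" using s by (simp flip: powr_add)
        then have "1 \<le> ennreal (s powr \<delta>) * ennreal (?w x)"
          by (simp flip: ennreal_mult ennreal_1)
        then show ?thesis by (auto simp: indicator_def intro: add_increasing)
      next
        case False
        have "s powr p \<le> G x powr p"
          using False s p by (intro powr_mono2) auto
        then have "s powr - p * s powr p \<le> s powr - p * G x powr p"
          by (rule mult_left_mono) simp
        then have "1 \<le> s powr - p * G x powr p" using s by (simp flip: powr_add)
        then have "1 \<le> ennreal (s powr - p) * ennreal (G x powr p)"
          by (simp flip: ennreal_mult ennreal_1)
        then show ?thesis by (auto simp: indicator_def intro: add_increasing2)
      qed
    qed
    also have "\<dots> = ennreal (s powr - p) * (\<integral>\<^sup>+x. ennreal (G x powr p) \<partial>lborel) +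
      ennreal (s powr \<delta>) * (\<integral>\<^sup>+x\<in>F. ennreal (?w x) \<partial>lborel)"
      by (simp add: nn_integral_add nn_integral_cmult)
    also have "\<dots> \<le> ennreal (s powr - p) * ennreal 16 + ennreal (s powr \<delta>) * ennreal ((D / t) powr p0)"
      using G_int level by (intro add_mono mult_left_mono) auto
    also have "\<dots> = ennreal (s powr - p * 16 + s powr \<delta> * (D / t) powr p0)"
      by (simp add: ennreal_mult')
    also have "s powr - p * 16 + s powr \<delta> * (D / t) powr p0 = 17 * (D / t) powr p"
    proof -
      have Dt: "D / t = inverse s" by (simp add: s_def)
      have "s powr \<delta> * inverse s powr p0 = s powr - p"
        using s by (simp add: \<delta>_def inverse_powr flip: powr_minus powr_add)
      moreover have "inverse s powr p = s powr - p"
        using s by (simp add: inverse_powr flip: powr_minus)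
      ultimately show ?thesis by (simp add: Dt)
    qed
    also have "ennreal (17 * (D / t) powr p) \<le> ennreal ((17 * D / t) powr p)"
    proof (rule ennreal_leI)
      have "(17::real) powr 1 \<le> 17 powr p" using p by (intro powr_mono) auto
      then have "17 * (D / t) powr p \<le> 17 powr p * (D / t) powr p"
        by (intro mult_right_mono) auto
      also have "\<dots> = (17 * D / t) powr p"
        using D0 t by (simp add: powr_mult[symmetric])
      finally show "17 * (D / t) powr p \<le> (17 * D / t) powr p" .
    qed
    finally show "emeasure lborel F \<le> ennreal ((17 * D / t) powr p)" .
  qed (use p D0 in auto)
  also have "17 * D = 17 * c * (2 * max 1 C / (p - 1)) powr ((p0 - 1) * \<beta>)"
    by (simp add: D_def A_def powr_powr)
  finally show ?thesis by (simp add: C_def)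
qed

text \<open>Duality: for \<open>F\<close> of measure \<open>M\<close>, the power
  \<open>M powr (p0 / p)\<close> is the integral over \<open>F\<close> of the normalised indicator
  \<open>h\<close>. This is at most 4 times the weighted measure of \<open>F\<close> for the
  majorant \<open>w\<close> of \<open>h\<close>, which the hypothesis controls.\<close>

lemma unw_op_norm_le_near_infinity:
  fixes T :: "('a::euclidean_space \<Rightarrow> real) \<Rightarrow> ('a \<Rightarrow> real)"
  assumes T: "weak_Ap_bound T p0 c \<beta>" and pc: "1 < p0" "0 < c" "0 < \<beta>"
    and p: "2 * p0 \<le> p"
  shows "unw_op_norm T p \<le> ennreal (4 * c * (A1_dim_const TYPE('a) * p) powr \<beta>)"
proof -
  define C where "C = A1_dim_const TYPE('a)"
  define D where "D = c * (C * p) powr \<beta>"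
  \<comment> \<open>The exponent conjugate to \<open>p / p0\<close>. The assumption
    \<open>2 * p0 <= p\<close> is exactly \<open>q <= 2\<close>, the range of the maximal
    estimate.\<close>
  define q where "q = p / (p - p0)"
  have C: "0 < C" unfolding C_def by (rule A1_dim_const_pos)
  have p0p: "0 < p" "p0 < p" "1 < p / p0" using p pc by (auto simp: pos_less_divide_eq)
  have q: "1 < q" "q \<le> 2" using p pc by (auto simp: q_def field_simps)
  have q1: "1 / q = 1 - p0 / p" using p0p by (simp add: q_def field_simps)
  have D0: "0 < D" using pc p0p C by (simp add: D_def)
  have "unw_op_norm T p \<le> ennreal (4 * D)"
  proof (rule unw_op_norm_le)
    fix f :: "'a \<Rightarrow> real" and t :: real and F
    assume f [measurable]: "f \<in> borel_measurable borel"
      and f_int: "(\<integral>\<^sup>+x. ennreal (\<bar>f x\<bar> powr p) \<partial>lborel) \<le> 1" and t: "0 < t"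
      and F [measurable]: "F \<in> sets borel" and FE: "F \<subseteq> {x. t < \<bar>T f x\<bar>}"
      and fin: "emeasure lborel F < top"
    show "emeasure lborel F \<le> ennreal ((4 * D / t) powr p)"
    proof (cases "emeasure lborel F = 0")
      case False
      then obtain M where M: "emeasure lborel F = ennreal M" "0 < M"
        using fin by (cases "emeasure lborel F") auto
      define h where "h = (\<lambda>x. indicator F x * M powr - (1 / q))"
      have h [measurable]: "h \<in> borel_measurable borel" unfolding h_def by measurable
      have "(\<integral>\<^sup>+x. ennreal (\<bar>h x\<bar> powr q) \<partial>lborel) = (\<integral>\<^sup>+x. ennreal (1 / M) * indicator F x \<partial>lborel)"
        using q M by (intro nn_integral_cong) (auto simp: h_def indicator_def powr_powr powr_minus_divide[of M 1])
      also have "\<dots> = 1"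
        using M by (simp add: nn_integral_cmult flip: ennreal_mult)
      finally have h_int: "(\<integral>\<^sup>+x. ennreal (\<bar>h x\<bar> powr q) \<partial>lborel) \<le> 1" by simp
      obtain w where w: "A1_weight (C / (q - 1)) w" and hw: "AE x in lborel. \<bar>h x\<bar> \<le> 4 * w x"
        and w_int: "(\<integral>\<^sup>+x. ennreal (w x powr q) \<partial>lborel) \<le> 1"
        unfolding C_def using A1_majorant[OF h q h_int] by blast
      have [measurable]: "w \<in> borel_measurable borel" and pos: "\<And>x. 0 < w x"
        using w by (auto simp: A1_weight_def)
      have Ap: "in_Ap p0 w" "Ap_const p0 w \<le> ennreal (C * p)"
      proof -
        show "in_Ap p0 w" using w pc(1) by (rule in_Ap_of_A1_weight)
        have "Ap_const p0 w \<le> ennreal (C / (q - 1))"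
          using w pc(1) by (rule in_Ap_of_A1_weight)
        also have "\<dots> \<le> ennreal (C * p)"
        proof (rule ennreal_leI)
          \<comment> \<open>The constant of the majorant grows only linearly in \<open>p\<close>;
            this is the source of the rate \<open>p powr \<beta>\<close>.\<close>
          have "1 / (q - 1) = (p - p0) / p0" using p0p pc by (simp add: q_def field_simps)
          also have "\<dots> \<le> p" using p0p pc
            by (simp add: pos_divide_le_eq) (smt (verit) mult_less_cancel_left1)
          finally have "C * (1 / (q - 1)) \<le> C * p" using C by (intro mult_left_mono) auto
          then show "C / (q - 1) \<le> C * p" by simp
        qed
        finally show "Ap_const p0 w \<le> ennreal (C * p)" .
      qed
      have "(\<integral>\<^sup>+x. ennreal (\<bar>f x\<bar> powr p0 * w x) \<partial>lborel) \<le>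
        (\<integral>\<^sup>+x. ennreal (p0 / p) * ennreal (\<bar>f x\<bar> powr p) + ennreal (1 / q) * ennreal (w x powr q) \<partial>lborel)"
      proof (intro nn_integral_mono)
        fix x
        \<comment> \<open>As \<open>f\<close> and \<open>w\<close> both lie in unit balls for
          conjugate exponents, Young's inequality pointwise gives the bound 1 that Hoelder's
          inequality would give.\<close>
        have "\<bar>f x\<bar> powr p0 * w x \<le> (\<bar>f x\<bar> powr p0) powr (p / p0) / (p / p0) + w x powr q / q"
          using p0p q q1 pos[of x] by (intro Youngs_inequality) auto
        also have "\<dots> = p0 / p * \<bar>f x\<bar> powr p + 1 / q * w x powr q"
          using pc by (simp add: powr_powr)
        finally show "ennreal (\<bar>f x\<bar> powr p0 * w x) \<le>
          ennreal (p0 / p) * ennreal (\<bar>f x\<bar> powr p) + ennreal (1 / q) * ennreal (w x powr q)"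
          using p0p pc q by (simp flip: ennreal_mult ennreal_plus add: ennreal_leI)
      qed
      also have "\<dots> = ennreal (p0 / p) * (\<integral>\<^sup>+x. ennreal (\<bar>f x\<bar> powr p) \<partial>lborel) +
        ennreal (1 / q) * (\<integral>\<^sup>+x. ennreal (w x powr q) \<partial>lborel)"
        by (simp add: nn_integral_add nn_integral_cmult)
      also have "\<dots> \<le> ennreal (p0 / p) * 1 + ennreal (1 / q) * 1"
        using f_int w_int by (intro add_mono mult_left_mono) auto
      also have "\<dots> = ennreal (p0 / p + 1 / q)"
        using p0p pc q by simp
      also have "\<dots> = 1" by (simp add: q1)
      finally have level: "(\<integral>\<^sup>+x\<in>F. ennreal (w x) \<partial>lborel) \<le> ennreal ((D / t) powr p0)"
        unfolding D_def using T pc Ap f t FE C p0p by (intro weak_Ap_bound_level_set[where T=T]) auto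
      have "ennreal (M powr (p0 / p)) = ennreal (M powr - (1 / q)) * ennreal M"
        using M powr_add[of M "- (1 / q)" 1] by (simp add: q1 flip: ennreal_mult)
      also have "\<dots> = (\<integral>\<^sup>+x. ennreal (M powr - (1 / q)) * indicator F x \<partial>lborel)"
        using M by (simp add: nn_integral_cmult)
      also have "\<dots> \<le> (\<integral>\<^sup>+x. 4 * (ennreal (w x) * indicator F x) \<partial>lborel)"
      proof (rule nn_integral_mono_AE)
        show "AE x in lborel. ennreal (M powr - (1 / q)) * indicator F x \<le> 4 * (ennreal (w x) * indicator F x)"
          using hw
        proof eventually_elim
          case (elim x)
          show ?case
          proof (cases "x \<in> F")
            case True
            with elim have "M powr - (1 / q) \<le> 4 * w x" by (simp add: h_def)
            then have "ennreal (M powr - (1 / q)) \<le> ennreal (4 * w x)" by (rule ennreal_leI)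
            then show ?thesis using True by (simp add: ennreal_mult')
          qed simp
        qed
      qed
      also have "\<dots> = 4 * (\<integral>\<^sup>+x\<in>F. ennreal (w x) \<partial>lborel)"
        by (simp add: nn_integral_cmult)
      also have "\<dots> \<le> 4 * ennreal ((D / t) powr p0)"
        using level by (rule mult_left_mono) simp
      also have "\<dots> = ennreal (4 * (D / t) powr p0)" by (simp add: ennreal_mult')
      finally have le: "M powr (p0 / p) \<le> 4 * (D / t) powr p0" by simp
      have "M = (M powr (p0 / p)) powr (p / p0)" using M p0p pc by (simp add: powr_powr)
      also have "\<dots> \<le> (4 * (D / t) powr p0) powr (p / p0)"
        using le p0p by (intro powr_mono2) auto
      also have "\<dots> = 4 powr (p / p0) * (D / t) powr p"
        using pc by (simp add: powr_mult powr_powr)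
      \<comment> \<open>Replacing \<open>p / p0\<close> by \<open>p\<close> lets the constant be
        absorbed as 4 inside the p-th power, uniformly in \<open>p\<close>.\<close>
      also have "\<dots> \<le> 4 powr p * (D / t) powr p"
        using pc p0p by (intro mult_right_mono powr_mono) (auto simp: pos_divide_le_eq)
      also have "\<dots> = (4 * D / t) powr p"
        using D0 t by (simp add: powr_mult[symmetric])
      finally show ?thesis using M by (simp add: ennreal_leI)
    qed simp
  qed (use p0p D0 in auto)
  then show ?thesis by (simp add: D_def C_def mult.assoc)
qed

section \<open>From the quantitative bounds to the exponents\<close>

theorem theorem1p1:
  fixes T :: "('a::euclidean_space \<Rightarrow> real) \<Rightarrow> ('a \<Rightarrow> real)"
    and p0 c \<beta> :: real
  assumes "1 < p0" and "0 < c" and "0 < \<beta>"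
    and "\<forall>w. in_Ap p0 w \<longrightarrow> weak_op_norm T p0 w \<le> ennreal c * enn_powr (Ap_const p0 w) \<beta>"
  shows "ereal \<beta> \<ge> max (gamma_T T) (alpha_T T / ereal (p0 - 1))"
proof -
  have T: "weak_Ap_bound T p0 c \<beta>" using assms(4) by (simp add: weak_Ap_bound_def)
  let ?C = "A1_dim_const TYPE('a)"
  have C: "0 < ?C" by (rule A1_dim_const_pos)
  have "\<gamma> \<le> \<beta>" if \<gamma>: "\<forall>\<epsilon>>0. Limsup at_top (\<lambda>p. unw_op_norm T p / ennreal (p powr (\<gamma> - \<epsilon>))) = top" for \<gamma>
  proof (rule ccontr)
    assume "\<not> \<gamma> \<le> \<beta>"
    \<comment> \<open>If \<open>\<gamma>\<close> exceeded \<open>\<beta>\<close>, the choice of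
      epsilon as their difference would turn the exponent into \<open>\<beta>\<close>, where the
      quotient stays bounded.\<close>
    with \<gamma>[rule_format, of "\<gamma> - \<beta>"]
    have "Limsup at_top (\<lambda>p. unw_op_norm T p / ennreal (p powr \<beta>)) = top" by simp
    moreover have "Limsup at_top (\<lambda>p. unw_op_norm T p / ennreal (p powr \<beta>)) \<le> ennreal (4 * c * ?C powr \<beta>)"
    proof (rule Limsup_bounded)
      show "\<forall>\<^sub>F p in at_top. unw_op_norm T p / ennreal (p powr \<beta>) \<le> ennreal (4 * c * ?C powr \<beta>)"
        using eventually_ge_at_top[of "2 * p0"]
      proof eventually_elim
        case (elim p)
        have p: "0 < p" using elim assms(1) by simp
        have "unw_op_norm T p / ennreal (p powr \<beta>) \<le> ennreal (4 * c * (?C * p) powr \<beta>) / ennreal (p powr \<beta>)"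
          using T assms elim by (intro divide_right_mono_ennreal unw_op_norm_le_near_infinity)
        also have "\<dots> = ennreal (4 * c * ?C powr \<beta>)"
          using p C assms by (simp add: divide_ennreal powr_mult)
        finally show ?case .
      qed
    qed
    ultimately show False by (simp add: top_unique)
  qed
  \<comment> \<open>The element 0 inserted into the supremum is covered by
    \<open>0 < \<beta>\<close>.\<close>
  then have "gamma_T T \<le> ereal \<beta>"
    unfolding gamma_T_def using assms(3) by (intro Sup_least) auto
  moreover have "\<alpha> \<le> (p0 - 1) * \<beta>"
    if \<alpha>: "\<forall>\<epsilon>>0. Limsup (at_right 1) (\<lambda>p. ennreal ((p - 1) powr (\<alpha> - \<epsilon>)) * unw_op_norm T p) = top" for \<alpha>
  proof (rule ccontr)
    let ?\<kappa> = "(p0 - 1) * \<beta>" and ?B = "17 * c * (2 * max 1 ?C) powr ((p0 - 1) * \<beta>)"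
    assume "\<not> \<alpha> \<le> ?\<kappa>"
    \<comment> \<open>Again epsilon is the excess over the critical exponent; the factor
      \<open>(p - 1) powr ?\<kappa>\<close> then cancels the blow-up of the bound near 1.\<close>
    with \<alpha>[rule_format, of "\<alpha> - ?\<kappa>"]
    have "Limsup (at_right 1) (\<lambda>p. ennreal ((p - 1) powr ?\<kappa>) * unw_op_norm T p) = top" by simp
    moreover have "Limsup (at_right 1) (\<lambda>p. ennreal ((p - 1) powr ?\<kappa>) * unw_op_norm T p) \<le> ennreal ?B"
    proof (rule Limsup_bounded)
      have "\<forall>\<^sub>F p in at_right 1. p \<in> {1<..<min p0 2}"
        using assms(1) by (intro eventually_at_right_real) auto
      then show "\<forall>\<^sub>F p in at_right 1. ennreal ((p - 1) powr ?\<kappa>) * unw_op_norm T p \<le> ennreal ?B"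
      proof eventually_elim
        case (elim p)
        then have p: "1 < p" "p < p0" "p \<le> 2" by auto
        have "ennreal ((p - 1) powr ?\<kappa>) * unw_op_norm T p \<le>
          ennreal ((p - 1) powr ?\<kappa>) * ennreal (17 * c * (2 * max 1 ?C / (p - 1)) powr ?\<kappa>)"
          using T assms p by (intro mult_left_mono unw_op_norm_le_near_one) auto
        also have "\<dots> = ennreal ?B"
          using p assms by (simp add: powr_divide flip: ennreal_mult)
        finally show ?case .
      qed
    qed
    ultimately show False by (simp add: top_unique)
  qed
  then have "alpha_T T \<le> ereal ((p0 - 1) * \<beta>)"
    unfolding alpha_T_def using assms(1,3) by (intro Sup_least) auto
  then have "alpha_T T / ereal (p0 - 1) \<le> ereal \<beta>"
    using assms(1) by (intro ereal_divide_le_pos[THEN iffD2]) auto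
  ultimately show ?thesis by simp
qed

end
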